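(* Let $n$ be an odd number, $h_n:=(n-1)/2$, and let $\ell$ be an integer with $1\le\ell\le h_n$. Let $U\subseteq\mathbb R^{n+1}$ be an axially symmetric open set and $f$ a left (resp. right) slice hyperholomorphic function on $U$. Then $D\Delta_{n+1}^{\ell-1}f$ (resp. $f\,D\Delta_{n+1}^{\ell-1}$, i.e. $D$ acting from the right) is a left (resp. right) axially polyharmonic function of degree $h_n-\ell+1$ on $U$.
   Context: $\mathbb R_n$ is the real Clifford algebra generated by $e_1,\dots,e_n$ with $e_ie_j+e_je_i=-2\delta_{ij}$. A point $(x_0,\dots,x_n)\in\mathbb R^{n+1}$ is identified with the paravector $x=x_0+\underline x$, $\underline x=\sum_{j=1}^n x_je_j$. $\mathbb S$ is the set of $\underline x$ with $|\underline x|=1$. $[x]=\{x_0+I|\underline x|: I\in\mathbb S\}$. An open $U\subset\mathbb R^{n+1}$ is axially symmetric if $[x]\subset U$ for all $x\in U$. For such $U$ let $\mathcal U=\{(u,v)\in\mathbb R^2: u+\mathbb S v\subset U\}$. $f:U\to\mathbb R_n$ is left (resp. right) slice hyperholomorphic if $f(u+Iv)=\alpha(u,v)+I\beta(u,v)$ (resp. $\alpha(u,v)+\beta(u,v)I$) for all $I\in\mathbb S$, $(u,v)\in\mathcal U$, with differentiable $\alpha,\beta:\mathcal U\to\mathbb R_n$ satisfying $\alpha(u,-v)=\alpha(u,v)$, $\beta(u,-v)=-\beta(u,v)$ and $\partial_u\alpha=\partial_v\beta$, $\partial_v\alpha=-\partial_u\beta$. $Df=\partial_{x_0}f+\sum_{i=1}^ne_i\partial_{x_i}f$,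 $fD=\partial_{x_0}f+\sum_{i=1}^n\partial_{x_i}f\,e_i$, $\Delta_{n+1}=\sum_{j=0}^n\partial_{x_j}^2$. A function $g:U\to\mathbb R_n$ is of left (resp. right) axial form if $g(x)=A(x_0,|\underline x|)+\underline\omega B(x_0,|\underline x|)$ (resp. $A+B\underline\omega$), $\underline\omega=\underline x/|\underline x|$, with $\mathbb R_n$-valued $A$ even and $B$ odd in the second variable. For an integer $k\ge1$, $g$ of class $\mathcal C^{2k}$ is left (resp. right) axially polyharmonic of degree $k$ if it is of left (resp. right) axial form and $\Delta_{n+1}^kg=0$ on $U$. *)

theory Defs
  imports "HOL-Analysis.Analysis"
begin

section \<open>The real Clifford algebra\<close>

text \<open>
  The generators are indexed by a finite linearly ordered type \<open>'n\<close>, so that \<open>n = CARD('n)\<close>.  An element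
  is given by its real coordinates with respect to the basis
  \<open>e\<^sub>A = e\<^sub>i\<^sub>1 \<dots> e\<^sub>i\<^sub>r\<close>, where \<open>A = {i\<^sub>1 < \<dots> < i\<^sub>r}\<close> ranges over the subsets of \<open>'n\<close>.
\<close>

typedef 'n clifford = "UNIV :: (('n::finite) set \<Rightarrow> real) set"
  morphisms coord Abs_clifford
  by simp

declare Abs_clifford_inverse [OF UNIV_I, simp]

lemma clifford_eq_iff: "x = y \<longleftrightarrow> (\<forall>A. coord x A = coord y A)"
  by (metis coord_inject ext)

instantiation clifford :: (finite) real_vector
begin

definition "(0 :: 'a clifford) = Abs_clifford (\<lambda>A. 0)"
definition "x + y = Abs_clifford (\<lambda>A. coord x A + coord y A)"
definition "x - y = Abs_clifford (\<lambda>A. coord x A - coord y A)"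
definition "- x = Abs_clifford (\<lambda>A. - coord x A)"
definition "r *\<^sub>R x = Abs_clifford (\<lambda>A. r * coord x A)"

instance
  by standard (simp_all add: clifford_eq_iff zero_clifford_def plus_clifford_def minus_clifford_def
      uminus_clifford_def scaleR_clifford_def algebra_simps)

end

instantiation clifford :: (finite) real_inner
begin

definition "inner x y = (\<Sum>A\<in>UNIV. coord x A * coord y A)"
definition "norm (x :: 'a clifford) = sqrt (inner x x)"
definition "sgn (x :: 'a clifford) = inverse (norm x) *\<^sub>R x"
definition "dist x y = norm (x - y :: 'a clifford)"
definition "(uniformity :: ('a clifford \<times> 'a clifford) filter)
  = (INF e\<in>{0 <..}. principal {(x, y). dist x y < e})"
definition "open (S :: 'a clifford set)
  \<longleftrightarrow> (\<forall>x\<in>S. \<forall>\<^sub>F (x', y) in uniformity. x' = x \<longrightarrow> y \<in> S)"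

instance
proof
  fix x y z :: "'a clifford" and r s :: real and S :: "'a clifford set"
  show "inner x x = 0 \<longleftrightarrow> x = 0"
    by (simp add: inner_clifford_def zero_clifford_def clifford_eq_iff sum_nonneg_eq_0_iff)
  show "inner x y = inner y x"
    by (simp add: inner_clifford_def mult.commute)
  show "inner (x + y) z = inner x z + inner y z"
    by (simp add: inner_clifford_def plus_clifford_def algebra_simps sum.distrib)
  show "inner (r *\<^sub>R x) y = r * inner x y"
    by (simp add: inner_clifford_def scaleR_clifford_def sum_distrib_left mult.assoc)
  show "0 \<le> inner x x"
    by (simp add: inner_clifford_def sum_nonneg)
  show "norm x = sqrt (inner x x)"
    by (rule norm_clifford_def)
  show "sgn x = x /\<^sub>R norm x"
    by (rule sgn_clifford_def)
  show "dist x y = norm (x - y)"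
    by (rule dist_clifford_def)
  show "(uniformity :: ('a clifford \<times> 'a clifford) filter)
    = (INF e\<in>{0 <..}. principal {(x, y). dist x y < e})"
    by (rule uniformity_clifford_def)
  show "open S \<longleftrightarrow> (\<forall>x\<in>S. \<forall>\<^sub>F (x', y) in uniformity. x' = x \<longrightarrow> y \<in> S)"
    by (rule open_clifford_def)
qed

end

definition blade :: "'n::finite set \<Rightarrow> 'n clifford" where
  "blade A = Abs_clifford (\<lambda>B. if B = A then 1 else 0)"

lemma coord_blade [simp]: "coord (blade A) B = (if B = A then 1 else 0)"
  by (simp add: blade_def)

lemma inner_blade: "inner x (blade A) = coord x A"
  by (simp add: inner_clifford_def if_distrib cong: if_cong)

instantiation clifford :: (finite) euclidean_space
begin

definition "Basis = range blade"

instance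
proof
  fix x u v :: "'a clifford"
  have inj: "blade A = blade B \<longleftrightarrow> A = B" for A B :: "'a set"
    by (auto simp: clifford_eq_iff split: if_splits)
  show "(Basis :: 'a clifford set) \<noteq> {}" "finite (Basis :: 'a clifford set)"
    by (simp_all add: Basis_clifford_def)
  show "inner u v = (if u = v then 1 else 0)" if "u \<in> Basis" "v \<in> Basis"
    using that by (auto simp: Basis_clifford_def inner_blade inj)
  show "(\<forall>u\<in>Basis. inner x u = 0) \<longleftrightarrow> x = 0"
    by (simp add: Basis_clifford_def inner_blade clifford_eq_iff zero_clifford_def)
qed

end

text \<open>
  \<open>e\<^sub>A e\<^sub>B = \<plusminus> e\<^sub>A\<^sub>\<triangle>\<^sub>B\<close>: moving the factors of \<open>e\<^sub>B\<close> into place costs a sign for every pair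
  \<open>b < a\<close>, and every common index costs a further sign since \<open>e\<^sub>i\<^sup>2 = -1\<close>.  The definition of the
  product collects the pairs \<open>(A, B)\<close> with \<open>A \<triangle> B = C\<close>, i.e. \<open>B = A \<triangle> C\<close>.
\<close>

definition blade_sign :: "'n::{finite,linorder} set \<Rightarrow> 'n set \<Rightarrow> real" where
  "blade_sign A B = (\<Prod>a\<in>A. \<Prod>b\<in>B. if b \<le> a then - 1 else 1)"

lemma prod_sym_diff:
  fixes f :: "'a::finite \<Rightarrow> real"
  assumes "\<And>a. f a * f a = 1"
  shows "prod f (sym_diff A B) = prod f A * prod f B"
proof -
  have "prod f A = prod f (A - B) * prod f (A \<inter> B)" "prod f B = prod f (B - A) * prod f (A \<inter> B)"
    by (subst prod.union_disjoint [symmetric]; auto intro: arg_cong [where f = "prod f"])+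
  moreover have "prod f (A \<inter> B) * prod f (A \<inter> B) = 1"
    by (simp add: assms flip: prod.distrib)
  moreover have "prod f (sym_diff A B) = prod f (A - B) * prod f (B - A)"
    by (rule prod.union_disjoint) auto
  ultimately show ?thesis
    by (simp add: algebra_simps)
qed

lemma blade_sign_sym_diff_left:
  "blade_sign (sym_diff A B) C = blade_sign A C * blade_sign B C"
  unfolding blade_sign_def
  by (rule prod_sym_diff) (auto simp flip: prod.distrib intro!: prod.neutral)

lemma blade_sign_sym_diff_right:
  "blade_sign A (sym_diff B C) = blade_sign A B * blade_sign A C"
  unfolding blade_sign_def
  by (subst prod_sym_diff) (simp_all add: prod.distrib)

lemma bij_sym_diff: "bij (\<lambda>B. sym_diff A B)"
  by (rule o_bij [where g = "\<lambda>B. sym_diff A B"]) (auto simp: fun_eq_iff)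

instantiation clifford :: ("{finite,linorder}") real_algebra_1
begin

definition "1 = blade {}"
definition "x * y = Abs_clifford
  (\<lambda>C. \<Sum>A\<in>UNIV. blade_sign A (sym_diff A C) * coord x A * coord y (sym_diff A C))"

instance
proof
  fix x y z :: "'a clifford" and r :: real
  show "x * y * z = x * (y * z)"
    unfolding clifford_eq_iff
  proof
    fix E :: "'a set"
    have sd: "sym_diff (sym_diff A B) E = sym_diff B (sym_diff A E)" for A B :: "'a set"
      by auto
    have "coord (x * y * z) E = (\<Sum>D\<in>UNIV. \<Sum>A\<in>UNIV. blade_sign D (sym_diff D E)
        * (blade_sign A (sym_diff A D) * coord x A * coord y (sym_diff A D)) * coord z (sym_diff D E))"
      by (simp add: times_clifford_def sum_distrib_left sum_distrib_right)
    also have "\<dots> = (\<Sum>A\<in>UNIV. \<Sum>D\<in>UNIV. blade_sign D (sym_diff D E)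
        * (blade_sign A (sym_diff A D) * coord x A * coord y (sym_diff A D)) * coord z (sym_diff D E))"
      by (rule sum.swap)
    also have "\<dots> = (\<Sum>A\<in>UNIV. \<Sum>B\<in>UNIV. blade_sign A (sym_diff A E) * coord x A
        * (blade_sign B (sym_diff B (sym_diff A E)) * coord y B * coord z (sym_diff B (sym_diff A E))))"
    proof (rule sum.cong [OF refl])
      fix A :: "'a set"
      have inv: "sym_diff A (sym_diff A B) = B" for B
        by auto
      have sign: "blade_sign (sym_diff A B) (sym_diff B F) * blade_sign A B
          = blade_sign A F * blade_sign B (sym_diff B F)" for B F
      proof -
        have "blade_sign A B * blade_sign A B = 1"
          by (auto simp: blade_sign_def simp flip: prod.distrib intro!: prod.neutral)
        then show ?thesis
          by (simp add: blade_sign_sym_diff_left blade_sign_sym_diff_right algebra_simps)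
      qed
      show "(\<Sum>D\<in>UNIV. blade_sign D (sym_diff D E)
          * (blade_sign A (sym_diff A D) * coord x A * coord y (sym_diff A D)) * coord z (sym_diff D E))
        = (\<Sum>B\<in>UNIV. blade_sign A (sym_diff A E) * coord x A
          * (blade_sign B (sym_diff B (sym_diff A E)) * coord y B * coord z (sym_diff B (sym_diff A E))))"
        (is "sum ?f UNIV = sum ?g UNIV")
      proof -
        have "sum ?f UNIV = (\<Sum>B\<in>UNIV. ?f (sym_diff A B))"
          by (rule sum.reindex_bij_betw [OF bij_sym_diff, symmetric])
        also have "\<dots> = sum ?g UNIV"
        proof (rule sum.cong [OF refl])
          fix B :: "'a set"
          show "?f (sym_diff A B) = ?g B"
            using sign [of B "sym_diff A E"] by (simp only: inv sd) algebra
        qed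
        finally show ?thesis .
      qed
    qed
    also have "\<dots> = coord (x * (y * z)) E"
      by (simp add: times_clifford_def sum_distrib_left)
    finally show "coord (x * y * z) E = coord (x * (y * z)) E" .
  qed
  show "1 * x = x"
  proof -
    have "(\<Sum>A\<in>UNIV. blade_sign A (sym_diff A C) * (if A = {} then 1 else 0) * coord x (sym_diff A C))
        = (\<Sum>A\<in>UNIV. if A = {} then blade_sign A (sym_diff A C) * coord x (sym_diff A C) else 0)" for C
      by (rule sum.cong) auto
    then show ?thesis
      by (simp add: one_clifford_def times_clifford_def clifford_eq_iff blade_sign_def)
  qed
  show "x * 1 = x"
  proof -
    have *: "sym_diff A C = {} \<longleftrightarrow> A = C" for A C :: "'a set"
      by auto
    have "(\<Sum>A\<in>UNIV. blade_sign A (sym_diff A C) * coord x A * (if sym_diff A C = {} then 1 else 0))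
        = (\<Sum>A\<in>UNIV. if A = C then blade_sign A (sym_diff A C) * coord x A else 0)" for C
      by (rule sum.cong) (auto simp: *)
    then show ?thesis
      by (simp add: one_clifford_def times_clifford_def clifford_eq_iff blade_sign_def)
  qed
  have "coord (1 :: 'a clifford) {} \<noteq> coord (0 :: 'a clifford) {}"
    by (simp add: one_clifford_def zero_clifford_def)
  then show "(0 :: 'a clifford) \<noteq> 1"
    by auto
qed (simp_all add: clifford_eq_iff times_clifford_def plus_clifford_def scaleR_clifford_def
      algebra_simps sum.distrib sum_distrib_left)

end

definition cgen :: "'n::{finite,linorder} \<Rightarrow> 'n clifford" where
  "cgen i = blade {i}"

lemma blade_mult: "blade A * blade B = blade_sign A B *\<^sub>R blade (sym_diff A B)"
proof -
  have "(\<Sum>D\<in>UNIV. blade_sign D (sym_diff D C) * (if D = A then 1 else 0)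
      * (if sym_diff D C = B then 1 else 0))
    = (\<Sum>D\<in>UNIV. if D = A then blade_sign A B * (if C = sym_diff A B then 1 else 0) else 0)" for C
    by (rule sum.cong) auto
  then show ?thesis
    by (simp add: times_clifford_def clifford_eq_iff scaleR_clifford_def)
qed

lemma clifford_relation: "cgen i * cgen j + cgen j * cgen i = (if i = j then - 2 else 0)"
proof (cases "i = j")
  case True
  then show ?thesis
    by (simp add: cgen_def blade_mult blade_sign_def flip: one_clifford_def)
next
  case False
  then have "sym_diff {i} {j} = {i, j}" "sym_diff {j} {i} = {i, j}"
    by auto
  with False show ?thesis
    by (auto simp: cgen_def blade_mult blade_sign_def simp flip: scaleR_add_left)
qed

lemma blade_insert: "(\<And>j. j \<in> A \<Longrightarrow> i < j) \<Longrightarrow> blade (insert i A) = cgen i * blade A"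
proof -
  assume *: "\<And>j. j \<in> A \<Longrightarrow> i < j"
  then have "sym_diff {i} A = insert i A"
    by auto
  moreover have "blade_sign {i} A = 1"
    using * by (auto simp: blade_sign_def intro!: prod.neutral) (meson leD)
  ultimately show ?thesis
    by (simp add: cgen_def blade_mult)
qed

section \<open>Slice hyperholomorphic and axially polyharmonic functions\<close>

text \<open>
  The paravector \<open>x\<^sub>0 + \<Sum>\<^sub>j x\<^sub>j e\<^sub>j\<close> is the pair \<open>(x\<^sub>0, (x\<^sub>j)\<^sub>j)\<close>; \<open>vec1\<close> embeds its second
  component into the Clifford algebra, and \<open>\<bbbS>\<close> is \<open>sphere 0 1\<close>.
\<close>

type_synonym 'n paravector = "real \<times> (real ^ 'n)"

definition vec1 :: "real ^ 'n::{finite,linorder} \<Rightarrow> 'n clifford" where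
  "vec1 v = (\<Sum>j\<in>UNIV. (v $ j) *\<^sub>R cgen j)"

definition axial_sphere :: "'n::finite paravector \<Rightarrow> 'n paravector set" where
  "axial_sphere x = {(fst x, norm (snd x) *\<^sub>R I) | I. I \<in> sphere 0 1}"

definition axially_symmetric :: "'n::finite paravector set \<Rightarrow> bool" where
  "axially_symmetric U \<longleftrightarrow> (\<forall>x\<in>U. axial_sphere x \<subseteq> U)"

definition slice_domain :: "'n::finite paravector set \<Rightarrow> (real \<times> real) set" where
  "slice_domain U = {(u, v). \<forall>I\<in>sphere 0 1. (u, v *\<^sub>R I) \<in> U}"

definition partial :: "'a::real_normed_vector \<Rightarrow> ('a \<Rightarrow> 'b::real_normed_vector) \<Rightarrow> 'a \<Rightarrow> 'b" where
  "partial b f x = vector_derivative (\<lambda>t. f (x + t *\<^sub>R b)) (at 0)"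

definition slice_pair ::
  "'n::finite paravector set \<Rightarrow> (real \<times> real \<Rightarrow> 'n clifford) \<Rightarrow> (real \<times> real \<Rightarrow> 'n clifford) \<Rightarrow> bool"
  where
  "slice_pair U \<alpha> \<beta> \<longleftrightarrow>
     \<alpha> differentiable_on slice_domain U \<and> \<beta> differentiable_on slice_domain U \<and>
     (\<forall>(u, v)\<in>slice_domain U.
        \<alpha> (u, - v) = \<alpha> (u, v) \<and> \<beta> (u, - v) = - \<beta> (u, v) \<and>
        partial (1, 0) \<alpha> (u, v) = partial (0, 1) \<beta> (u, v) \<and>
        partial (0, 1) \<alpha> (u, v) = - partial (1, 0) \<beta> (u, v))"

definition left_slice_hyperholomorphic ::
  "'n::{finite,linorder} paravector set \<Rightarrow> ('n paravector \<Rightarrow> 'n clifford) \<Rightarrow> bool" where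
  "left_slice_hyperholomorphic U f \<longleftrightarrow> (\<exists>\<alpha> \<beta>. slice_pair U \<alpha> \<beta> \<and>
     (\<forall>(u, v)\<in>slice_domain U. \<forall>I\<in>sphere 0 1. f (u, v *\<^sub>R I) = \<alpha> (u, v) + vec1 I * \<beta> (u, v)))"

definition right_slice_hyperholomorphic ::
  "'n::{finite,linorder} paravector set \<Rightarrow> ('n paravector \<Rightarrow> 'n clifford) \<Rightarrow> bool" where
  "right_slice_hyperholomorphic U f \<longleftrightarrow> (\<exists>\<alpha> \<beta>. slice_pair U \<alpha> \<beta> \<and>
     (\<forall>(u, v)\<in>slice_domain U. \<forall>I\<in>sphere 0 1. f (u, v *\<^sub>R I) = \<alpha> (u, v) + \<beta> (u, v) * vec1 I))"

definition dirac_left ::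
  "('n::{finite,linorder} paravector \<Rightarrow> 'n clifford) \<Rightarrow> 'n paravector \<Rightarrow> 'n clifford" where
  "dirac_left f x = partial (1, 0) f x + (\<Sum>i\<in>UNIV. cgen i * partial (0, axis i 1) f x)"

definition dirac_right ::
  "('n::{finite,linorder} paravector \<Rightarrow> 'n clifford) \<Rightarrow> 'n paravector \<Rightarrow> 'n clifford" where
  "dirac_right f x = partial (1, 0) f x + (\<Sum>i\<in>UNIV. partial (0, axis i 1) f x * cgen i)"

definition laplacian ::
  "('n::finite paravector \<Rightarrow> 'n clifford) \<Rightarrow> 'n paravector \<Rightarrow> 'n clifford" where
  "laplacian f x = partial (1, 0) (partial (1, 0) f) x
     + (\<Sum>j\<in>UNIV. partial (0, axis j 1) (partial (0, axis j 1) f) x)"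

text \<open>Class \<open>C\<^sup>k\<close> on an open set: all iterated partial derivatives up to order \<open>k\<close> exist and are
  continuous.\<close>

fun Ck_on :: "nat \<Rightarrow> ('a::euclidean_space \<Rightarrow> 'b::real_normed_vector) \<Rightarrow> 'a set \<Rightarrow> bool" where
  "Ck_on 0 f U \<longleftrightarrow> continuous_on U f"
| "Ck_on (Suc k) f U \<longleftrightarrow> continuous_on U f \<and>
     (\<forall>b\<in>Basis. (\<forall>x\<in>U. (\<lambda>t. f (x + t *\<^sub>R b)) differentiable (at 0)) \<and> Ck_on k (partial b f) U)"

text \<open>
  At points with \<open>snd x = 0\<close> the direction \<open>\<omega> = vec1 (snd x /\<^sub>R norm (snd x))\<close> evaluates to \<open>0\<close>; there
  \<open>B (fst x, 0) = 0\<close> by oddness, so the choice of \<open>\<omega>\<close> is immaterial.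
\<close>

definition axial_pair ::
  "'n::finite paravector set \<Rightarrow> (real \<times> real \<Rightarrow> 'n clifford) \<Rightarrow> (real \<times> real \<Rightarrow> 'n clifford) \<Rightarrow> bool"
  where
  "axial_pair U A B \<longleftrightarrow>
     (\<forall>(u, v)\<in>slice_domain U. A (u, - v) = A (u, v) \<and> B (u, - v) = - B (u, v))"

definition left_axial_form ::
  "'n::{finite,linorder} paravector set \<Rightarrow> ('n paravector \<Rightarrow> 'n clifford) \<Rightarrow> bool" where
  "left_axial_form U g \<longleftrightarrow> (\<exists>A B. axial_pair U A B \<and>
     (\<forall>x\<in>U. g x = A (fst x, norm (snd x))
        + vec1 (snd x /\<^sub>R norm (snd x)) * B (fst x, norm (snd x))))"

definition right_axial_form ::
  "'n::{finite,linorder} paravector set \<Rightarrow> ('n paravector \<Rightarrow> 'n clifford) \<Rightarrow> bool" where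
  "right_axial_form U g \<longleftrightarrow> (\<exists>A B. axial_pair U A B \<and>
     (\<forall>x\<in>U. g x = A (fst x, norm (snd x))
        + B (fst x, norm (snd x)) * vec1 (snd x /\<^sub>R norm (snd x))))"

definition left_axially_polyharmonic ::
  "nat \<Rightarrow> 'n::{finite,linorder} paravector set \<Rightarrow> ('n paravector \<Rightarrow> 'n clifford) \<Rightarrow> bool" where
  "left_axially_polyharmonic k U g \<longleftrightarrow>
     Ck_on (2 * k) g U \<and> left_axial_form U g \<and> (\<forall>x\<in>U. (laplacian ^^ k) g x = 0)"

definition right_axially_polyharmonic ::
  "nat \<Rightarrow> 'n::{finite,linorder} paravector set \<Rightarrow> ('n paravector \<Rightarrow> 'n clifford) \<Rightarrow> bool" where
  "right_axially_polyharmonic k U g \<longleftrightarrow>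
     Ck_on (2 * k) g U \<and> right_axial_form U g \<and> (\<forall>x\<in>U. (laplacian ^^ k) g x = 0)"

end

(* Write x = u + x_ with |x_| = v and Q(s,x) = (s - u)^2 + |x_|^2.  The components of a slice
   hyperholomorphic f are holomorphic functions F of z = u + iv with F(cnj z) = cnj (F z), so adding and
   subtracting Cauchy's formula at z and at cnj z gives, locally and across the real axis,
   f(x) = Re (int F (s - u) / Q) + x_ Re (int F / Q), with kernels smooth in x.  With
   J_m ~ Q^(-m) and S_m ~ (s - u + x_) Q^(-m), differentiation under the integral yields
     Lap S_m = 2m(2m - 1 - n) S_(m+1),  D S_m = (2m - 1 - n) J_m,  Lap J_m = 2m(2m + 1 - n) J_(m+1).
   Hence D Lap^(l-1) f is locally a multiple of J_l, and the last factor vanishes for m = (n - 1)/2. *)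
theory Submission
  imports Defs "HOL-Complex_Analysis.Cauchy_Integral_Formula"
begin

section \<open>Directional derivatives and classes of differentiability\<close>

text \<open>The obstacle is the real axis: f is given through functions of u and v = |x_|, and
  dividing the vector part by v threatens every derivative at v = 0. In the integrals x enters only
  through u, x_ and |x_|^2, so the same formulas hold on and off the axis. With the complex unit
  treated as commuting with the Clifford units, Q = (s - x)(s - u + x_), so S_1 is the Cauchy kernel
  (s - x)^(-1). Q itself is the squared distance in R^(n+1) from x to the axis point s, continued to
  complex s; hence the constants for J_m are those of the Laplacian of r^(-2m) in dimension n + 1,
  and Q^(-h) with 2h = n - 1 is the Newtonian kernel r^(1-n), harmonic in x. Oddness of n makes h an
  integer, which keeps this power single-valued on the contour. J_l depends on x only through u and
  |x_|, so the axial form has B = 0 and one argument serves both sides. In the left case the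
  Laplacians act on S_m and D comes last; in the right case D comes first and the Laplacians act on
  J_m, so the operators are never commuted.\<close>

definition has_partial ::
  "'a::real_normed_vector \<Rightarrow> ('a \<Rightarrow> 'b::real_normed_vector) \<Rightarrow> 'b \<Rightarrow> 'a \<Rightarrow> bool" where
  "has_partial b f d x \<longleftrightarrow> ((\<lambda>t. f (x + t *\<^sub>R b)) has_vector_derivative d) (at 0)"

lemma partial_eqI: "has_partial b f d x \<Longrightarrow> partial b f x = d"
  unfolding has_partial_def partial_def by (rule vector_derivative_at)

lemma has_partial_partial:
  "(\<lambda>t. f (x + t *\<^sub>R b)) differentiable (at 0) \<Longrightarrow> has_partial b f (partial b f x) x"
  unfolding has_partial_def partial_def by (simp add: vector_derivative_works)

lemma has_partial_imp_differentiable: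
  "has_partial b f d x \<Longrightarrow> (\<lambda>t. f (x + t *\<^sub>R b)) differentiable (at 0)"
  unfolding has_partial_def by (rule differentiableI_vector)

lemma eventually_line:
  fixes x b :: "'a::real_normed_vector"
  assumes "open V" "x \<in> V"
  shows "\<forall>\<^sub>F t in nhds 0. x + t *\<^sub>R b \<in> V"
proof -
  have "((\<lambda>t. x + t *\<^sub>R b) \<longlongrightarrow> x + 0 *\<^sub>R b) (nhds 0)"
    by (intro tendsto_intros filterlim_ident)
  with assms show ?thesis
    by (simp add: tendsto_def)
qed

lemma has_partial_cong:
  assumes "has_partial b g d x" "open V" "x \<in> V" "\<And>y. y \<in> V \<Longrightarrow> f y = g y"
  shows "has_partial b f d x"
proof -
  have "\<forall>\<^sub>F t in nhds 0. f (x + t *\<^sub>R b) = g (x + t *\<^sub>R b)"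
    using eventually_line [OF assms(2,3)] by eventually_elim (rule assms(4))
  with assms(1) show ?thesis
    unfolding has_partial_def by (subst has_vector_derivative_cong_ev) (auto dest: eventually_nhds_x_imp_x)
qed

text \<open>\<open>vector_derivative\<close> chooses from the set of derivatives along the line, and
  that set depends only on the germ. The equality thus holds whether or not a derivative exists, and
  it can be iterated.\<close>

lemma partial_cong:
  assumes "open V" "x \<in> V" "\<And>y. y \<in> V \<Longrightarrow> f y = g y"
  shows "partial b f x = partial b g x"
proof -
  have "\<forall>\<^sub>F t in nhds 0. f (x + t *\<^sub>R b) = g (x + t *\<^sub>R b)"
    using eventually_line [OF assms(1,2)] by eventually_elim (rule assms(3))
  then show ?thesis
    unfolding partial_def by (intro vector_derivative_cong_eq) auto
qed

lemma laplacian_cong: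
  assumes "open V" "x \<in> V" "\<And>y. y \<in> V \<Longrightarrow> f y = g y"
  shows "laplacian f x = laplacian g x"
proof -
  have "partial b (partial b f) x = partial b (partial b g) x" for b
    by (rule partial_cong [OF assms(1,2)]) (rule partial_cong [OF assms(1) _ assms(3)])
  then show ?thesis by (simp add: laplacian_def)
qed

lemma dirac_left_cong:
  assumes "open V" "x \<in> V" "\<And>y. y \<in> V \<Longrightarrow> f y = g y"
  shows "dirac_left f x = dirac_left g x"
  by (simp add: dirac_left_def partial_cong [OF assms])

lemma dirac_right_cong:
  assumes "open V" "x \<in> V" "\<And>y. y \<in> V \<Longrightarrow> f y = g y"
  shows "dirac_right f x = dirac_right g x"
  by (simp add: dirac_right_def partial_cong [OF assms])

lemma Ck_on_cong:
  assumes "open U" "\<And>x. x \<in> U \<Longrightarrow> f x = g x" "Ck_on k g U"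
  shows "Ck_on k f U"
  using assms(2,3)
proof (induction k arbitrary: f g)
  case 0
  then show ?case by (simp cong: continuous_on_cong)
next
  case (Suc k)
  have "continuous_on U f" using Suc.prems by (simp cong: continuous_on_cong)
  moreover have "(\<lambda>t. f (x + t *\<^sub>R b)) differentiable (at 0)" if "b \<in> Basis" "x \<in> U" for b x
  proof (rule has_partial_imp_differentiable)
    have "(\<lambda>t. g (x + t *\<^sub>R b)) differentiable (at 0)"
      using Suc.prems(2) that by simp
    then show "has_partial b f (partial b g x) x"
      by (rule has_partial_cong [OF has_partial_partial assms(1) that(2) Suc.prems(1)])
  qed
  moreover have "Ck_on k (partial b f) U" if "b \<in> Basis" for b
    using Suc.prems that by (intro Suc.IH [of "partial b f" "partial b g"] partial_cong [OF assms(1)]) auto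
  ultimately show ?case by auto
qed

lemma Ck_on_SucI:
  assumes "open U" "continuous_on U f"
    and "\<And>b x. b \<in> Basis \<Longrightarrow> x \<in> U \<Longrightarrow> has_partial b f (f' b x) x"
    and "\<And>b. b \<in> Basis \<Longrightarrow> Ck_on k (f' b) U"
  shows "Ck_on (Suc k) f U"
  using assms(2)
  by (auto intro: has_partial_imp_differentiable [OF assms(3)]
      Ck_on_cong [OF assms(1) partial_eqI [OF assms(3)] assms(4)])

lemma Ck_on_SucE:
  assumes "Ck_on (Suc k) f U"
  shows "continuous_on U f"
    and "\<And>b x. b \<in> Basis \<Longrightarrow> x \<in> U \<Longrightarrow> has_partial b f (partial b f x) x"
    and "\<And>b. b \<in> Basis \<Longrightarrow> Ck_on k (partial b f) U"
  using assms by (auto intro: has_partial_partial)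

lemma Ck_on_Suc_imp: "Ck_on (Suc k) f U \<Longrightarrow> Ck_on k f U"
  by (induction k arbitrary: f) (simp, metis Ck_on.simps(2))

text \<open>Continuity and partial derivatives at a point depend only on a neighbourhood. This glues
  the kernel representations, which exist only near each point.\<close>

lemma Ck_on_locally:
  assumes "\<And>x. x \<in> U \<Longrightarrow> \<exists>V. open V \<and> x \<in> V \<and> V \<subseteq> U \<and> Ck_on k f V"
  shows "Ck_on k f U"
  using assms
proof (induction k arbitrary: f)
  case 0
  have "continuous (at x) f" if "x \<in> U" for x
    using 0 [OF that] by (auto simp: continuous_on_eq_continuous_at)
  then show ?case by (auto intro: continuous_at_imp_continuous_on)
next
  case (Suc k)
  have "continuous (at x) f" if "x \<in> U" for x
    using Suc.prems [OF that] by (auto simp: continuous_on_eq_continuous_at)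
  then have "continuous_on U f" by (auto intro: continuous_at_imp_continuous_on)
  moreover have "(\<lambda>t. f (x + t *\<^sub>R b)) differentiable (at 0)" if "b \<in> Basis" "x \<in> U" for b x
    using Suc.prems that by force
  moreover have "Ck_on k (partial b f) U" if "b \<in> Basis" for b
    using Suc.prems that by (intro Suc.IH) (metis Ck_on.simps(2))
  ultimately show ?case by auto
qed

lemma has_partial_add:
  "has_partial b f d x \<Longrightarrow> has_partial b g e x \<Longrightarrow> has_partial b (\<lambda>x. f x + g x) (d + e) x"
  unfolding has_partial_def by (rule has_vector_derivative_add)

lemma has_partial_diff:
  "has_partial b f d x \<Longrightarrow> has_partial b g e x \<Longrightarrow> has_partial b (\<lambda>x. f x - g x) (d - e) x"
  unfolding has_partial_def by (rule has_vector_derivative_diff)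

lemma has_partial_bounded_linear:
  "bounded_linear L \<Longrightarrow> has_partial b f d x \<Longrightarrow> has_partial b (\<lambda>x. L (f x)) (L d) x"
  unfolding has_partial_def by (rule bounded_linear.has_vector_derivative)

lemma has_partial_linear:
  "bounded_linear L \<Longrightarrow> has_partial b L (L b) x"
  unfolding has_partial_def
  by (auto intro!: derivative_eq_intros simp: linear_simps)

lemma (in bounded_bilinear) has_partial:
  assumes "has_partial b f d x" "has_partial b g e x"
  shows "has_partial b (\<lambda>x. prod (f x) (g x)) (prod (f x) e + prod d (g x)) x"
  using has_vector_derivative [OF assms [unfolded has_partial_def]]
  unfolding has_partial_def by simp

lemma Ck_on_const: "Ck_on k (\<lambda>_. c) U"
proof (induction k arbitrary: c)
  case (Suc k)
  have "partial b (\<lambda>_. c) = (\<lambda>_. 0)" for b :: 'a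
    by (simp add: partial_def fun_eq_iff)
  then show ?case using Suc by simp
qed simp

lemma Ck_on_add:
  assumes "open U" "Ck_on k f U" "Ck_on k g U"
  shows "Ck_on k (\<lambda>x. f x + g x) U"
  using assms(2,3)
proof (induction k arbitrary: f g)
  case (Suc k)
  note f = Ck_on_SucE [OF Suc.prems(1)] and g = Ck_on_SucE [OF Suc.prems(2)]
  show ?case
    by (rule Ck_on_SucI [OF assms(1)])
      (auto intro!: has_partial_add continuous_on_add f g Suc.IH [OF f(3) g(3)])
qed (simp add: continuous_on_add)

lemma Ck_on_diff:
  assumes "open U" "Ck_on k f U" "Ck_on k g U"
  shows "Ck_on k (\<lambda>x. f x - g x) U"
  using assms(2,3)
proof (induction k arbitrary: f g)
  case (Suc k)
  note f = Ck_on_SucE [OF Suc.prems(1)] and g = Ck_on_SucE [OF Suc.prems(2)]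
  show ?case
    by (rule Ck_on_SucI [OF assms(1)])
      (auto intro!: has_partial_diff continuous_on_diff f g Suc.IH [OF f(3) g(3)])
qed (simp add: continuous_on_diff)

lemma (in bounded_bilinear) Ck_on:
  fixes f :: "'d::euclidean_space \<Rightarrow> 'a"
  assumes "open U" "Ck_on k f U" "Ck_on k g U"
  shows "Ck_on k (\<lambda>x. prod (f x) (g x)) U"
  using assms(2,3)
proof (induction k arbitrary: f g)
  case (Suc k)
  note f = Ck_on_SucE [OF Suc.prems(1)] and g = Ck_on_SucE [OF Suc.prems(2)]
  show ?case
  proof (rule Ck_on_SucI [OF assms(1)])
    show "continuous_on U (\<lambda>x. prod (f x) (g x))" by (intro continuous_on f g)
    show "has_partial b (\<lambda>x. prod (f x) (g x)) (f x ** partial b g x + prod (partial b f x) (g x)) x"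
      if "b \<in> Basis" "x \<in> U" for b x
      using that by (intro has_partial f g)
    show "Ck_on k (\<lambda>x. f x ** partial b g x + prod (partial b f x) (g x)) U" if "b \<in> Basis" for b
      using that by (intro Ck_on_add [OF assms(1)] Suc.IH f(3) g(3)
          Ck_on_Suc_imp [OF Suc.prems(1)] Ck_on_Suc_imp [OF Suc.prems(2)])
  qed
qed (simp add: continuous_on)

lemmas Ck_on_mult = bounded_bilinear.Ck_on [OF bounded_bilinear_mult]
lemmas Ck_on_inner = bounded_bilinear.Ck_on [OF bounded_bilinear_inner]
lemmas Ck_on_scaleR = bounded_bilinear.Ck_on [OF bounded_bilinear_scaleR]

lemma Ck_on_linear:
  assumes "open U" "bounded_linear L"
  shows "Ck_on k L U"
proof (cases k)
  case 0
  then show ?thesis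
    by (simp add: assms(2) linear_continuous_on)
next
  case (Suc m)
  show ?thesis
    unfolding Suc
    by (rule Ck_on_SucI [where f' = "\<lambda>b _. L b"])
      (intro assms has_partial_linear linear_continuous_on Ck_on_const)+
qed

section \<open>Coordinates and products in the Clifford algebra\<close>

lemma coord_simps [simp]:
  "coord 0 A = 0" "coord (x + y) A = coord x A + coord y A" "coord (x - y) A = coord x A - coord y A"
  "coord (- x) A = - coord x A" "coord (r *\<^sub>R x) A = r * coord x A"
  by (simp_all add: zero_clifford_def plus_clifford_def minus_clifford_def uminus_clifford_def
      scaleR_clifford_def)

lemma coord_sum: "coord (sum f S) A = (\<Sum>i\<in>S. coord (f i) A)"
  by (induction S rule: infinite_finite_induct) simp_all

lemma coord_sum_blade [simp]: "coord (\<Sum>A\<in>UNIV. f A *\<^sub>R blade A) B = f B"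
  by (simp add: coord_sum if_distrib cong: if_cong)

lemma vec1_axis: "vec1 (axis i 1) = cgen i"
  by (simp add: vec1_def axis_def if_distrib if_distribR cong: if_cong)

lemma linear_vec1: "linear vec1"
  by (rule linearI) (simp_all add: vec1_def scaleR_add_left sum.distrib scaleR_sum_right)

lemma cgen_mult_self: "cgen i * cgen i = - 1"
proof -
  have "2 *\<^sub>R (cgen i * cgen i) = 2 *\<^sub>R (- 1 :: 'a clifford)"
    using clifford_relation [of i i] by (simp add: scaleR_2)
  then show ?thesis by (metis scaleR_cancel_left zero_neq_numeral)
qed

lemma cgen_mult_cgen_mult: "cgen i * (cgen i * a) = - a"
  by (simp add: cgen_mult_self flip: mult.assoc)

text \<open>Averaging the double sum with its transpose leaves anticommutators, of which only the
  diagonal ones survive.\<close>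

lemma vec1_mult_self: "vec1 v * vec1 v = - ((v \<bullet> v) *\<^sub>R 1)"
proof -
  let ?s = "\<Sum>i\<in>UNIV. \<Sum>j\<in>UNIV. (v $ i * v $ j) *\<^sub>R (cgen i * cgen j :: 'a clifford)"
  have s: "vec1 v * vec1 v = ?s"
    by (simp add: vec1_def sum_product mult.commute)
  have "?s = (\<Sum>i\<in>UNIV. \<Sum>j\<in>UNIV. (v $ j * v $ i) *\<^sub>R (cgen j * cgen i))"
    by (rule sum.swap)
  also have "\<dots> = (\<Sum>i\<in>UNIV. \<Sum>j\<in>UNIV. (v $ i * v $ j) *\<^sub>R (cgen j * cgen i))"
    by (intro sum.cong refl arg_cong2 [where f = scaleR]) (rule mult.commute)
  finally have "2 *\<^sub>R ?s = (\<Sum>i\<in>UNIV. \<Sum>j\<in>UNIV. (v $ i * v $ j) *\<^sub>R (cgen i * cgen j + cgen j * cgen i))"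
    by (simp add: scaleR_2 scaleR_add_right sum.distrib)
  also have "\<dots> = (\<Sum>i\<in>UNIV. (v $ i * v $ i) *\<^sub>R (- 2))"
    by (simp add: clifford_relation if_distrib cong: if_cong)
  also have "\<dots> = 2 *\<^sub>R (- ((v \<bullet> v) *\<^sub>R 1))"
  proof -
    have "(v $ i * v $ i) *\<^sub>R (- 2 :: 'a clifford) = (- 2 * (v $ i * v $ i)) *\<^sub>R 1" for i
      by (simp add: algebra_simps scaleR_2 flip: scaleR_scaleR)
    then show ?thesis
      by (simp add: inner_vec_def sum_negf flip: scaleR_sum_left sum_distrib_left)
  qed
  finally have "2 *\<^sub>R (vec1 v * vec1 v) = 2 *\<^sub>R (- ((v \<bullet> v) *\<^sub>R 1 :: 'a clifford))"
    by (simp only: s)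
  then show ?thesis by (simp only: scaleR_cancel_left) simp
qed

section \<open>Calculus of the axial kernels\<close>

text \<open>First derivatives are required on all of \<open>V\<close> because they are
  differentiated again; the second ones only at \<open>x\<close>.\<close>

lemma laplacian_eqI:
  assumes "open V" "x \<in> V"
    and "\<And>y. y \<in> V \<Longrightarrow> has_partial (1, 0) f (p y) y" "has_partial (1, 0) p a x"
    and "\<And>j y. y \<in> V \<Longrightarrow> has_partial (0, axis j 1) f (q j y) y"
    and "\<And>j. has_partial (0, axis j 1) (q j) (b j) x"
  shows "laplacian f x = a + (\<Sum>j\<in>UNIV. b j)"
proof -
  have "partial (1, 0) (partial (1, 0) f) x = a"
    using assms(3) by (intro partial_eqI has_partial_cong [OF assms(4,1,2)])
  moreover have "partial (0, axis j 1) (partial (0, axis j 1) f) x = b j" for j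
    using assms(5) by (intro partial_eqI has_partial_cong [OF assms(6,1,2)])
  ultimately show ?thesis by (simp add: laplacian_def)
qed

lemma has_partial_scaleR_const:
  "has_partial b f d x \<Longrightarrow> has_partial b (\<lambda>x. c *\<^sub>R f x) (c *\<^sub>R d) x"
  by (rule has_partial_bounded_linear [OF bounded_linear_scaleR_right])

lemma has_partial_fst: "has_partial b fst (fst b) x"
  by (rule has_partial_linear [OF bounded_linear_fst])

lemma has_partial_inner_snd: "has_partial b (\<lambda>x. snd x \<bullet> c) (snd b \<bullet> c) x"
  by (rule has_partial_linear)
    (rule bounded_linear_compose [OF bounded_linear_inner_left bounded_linear_snd])

lemma has_partial_snd_norm_sq: "has_partial b (\<lambda>x. snd x \<bullet> snd x) (2 * (snd x \<bullet> snd b)) x"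
proof -
  have "2 * (snd x \<bullet> snd b) = snd x \<bullet> snd b + snd b \<bullet> snd x"
    by (simp add: inner_commute)
  then show ?thesis
    by (simp only:) (intro bounded_bilinear.has_partial [OF bounded_bilinear_inner]
        has_partial_linear bounded_linear_snd)
qed

lemma has_partial_vec1_snd: "has_partial b (\<lambda>x. vec1 (snd x)) (vec1 (snd b)) x"
  by (rule has_partial_linear)
    (intro bounded_linear_compose [OF linear_conv_bounded_linear [THEN iffD1, OF linear_vec1]]
      bounded_linear_snd)

lemma bounded_bilinear_clifford_mult:
  "bounded_bilinear ((*) :: 'n::{finite,linorder} clifford \<Rightarrow> 'n clifford \<Rightarrow> 'n clifford)"
  unfolding bilinear_conv_bounded_bilinear [symmetric]
  by (auto simp: bilinear_def linear_iff algebra_simps)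

lemmas has_partial_mult = bounded_bilinear.has_partial [OF bounded_bilinear_clifford_mult]
lemmas has_partial_scaleR = bounded_bilinear.has_partial [OF bounded_bilinear_scaleR]

lemma sum_scaleR_nth_sq: "(\<Sum>j\<in>UNIV. (v $ j * v $ j) *\<^sub>R a) = (v \<bullet> v) *\<^sub>R a"
  for v :: "real ^ 'm" and a :: "'a::real_normed_vector"
  by (simp add: inner_vec_def scaleR_sum_left)

lemma sum_nth_cgen_mult: "(\<Sum>j\<in>UNIV. (v $ j) *\<^sub>R (cgen j * a)) = vec1 v * a"
  by (simp add: vec1_def sum_distrib_right)

text \<open>\<open>J m\<close> and \<open>N m\<close> behave like \<open>Q\<^sup>-\<^sup>m\<close> and \<open>(s - x\<^sub>0) Q\<^sup>-\<^sup>m\<close> with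
  \<open>Q = (s - x\<^sub>0)\<^sup>2 + \<bar>x\<bar>\<^sup>2\<close> for the vector part \<open>x\<close>; the derivative of \<open>N m\<close> eliminates \<open>(s - x\<^sub>0)\<^sup>2\<close>
  through \<open>Q\<close>.\<close>

locale axial_kernels =
  fixes V :: "'n::{finite,linorder} paravector set"
    and J N :: "nat \<Rightarrow> 'n paravector \<Rightarrow> 'n clifford"
  assumes open_V: "open V"
    and continuous_J: "continuous_on V (J m)"
    and continuous_N: "continuous_on V (N m)"
    and has_partial_J: "x \<in> V \<Longrightarrow> has_partial b (J m)
      ((2 * real m) *\<^sub>R (fst b *\<^sub>R N (Suc m) x - (snd x \<bullet> snd b) *\<^sub>R J (Suc m) x)) x"
    and has_partial_N: "x \<in> V \<Longrightarrow> has_partial b (N m)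
      (fst b *\<^sub>R ((2 * real m - 1) *\<^sub>R J m x - (2 * real m * (snd x \<bullet> snd x)) *\<^sub>R J (Suc m) x)
        - (2 * real m * (snd x \<bullet> snd b)) *\<^sub>R N (Suc m) x) x"
begin

text \<open>Each first derivative combines kernels of index \<open>m\<close> and
  \<open>Suc m\<close> with coefficients polynomial in the vector part. The family is closed under
  differentiation, so the induction runs over all \<open>m\<close> and both kernels at once.\<close>

lemma Ck_on_JN: "Ck_on k (J m) V \<and> Ck_on k (N m) V"
proof (induction k arbitrary: m)
  case 0
  then show ?case by (simp add: continuous_J continuous_N)
next
  case (Suc k)
  have lin: "Ck_on k (\<lambda>x. snd x \<bullet> c) V" for c
    by (intro Ck_on_linear open_V bounded_linear_compose [OF bounded_linear_inner_left bounded_linear_snd])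
  have JN: "Ck_on k (J m) V" "Ck_on k (N m) V" for m
    using Suc.IH by auto
  have "Ck_on (Suc k) (J m) V"
    by (rule Ck_on_SucI [OF open_V continuous_J has_partial_J], assumption)
      (intro JN Ck_on_scaleR Ck_on_diff Ck_on_const lin open_V)
  moreover have "Ck_on (Suc k) (N m) V"
    by (rule Ck_on_SucI [OF open_V continuous_N has_partial_N], assumption)
      (intro JN Ck_on_scaleR Ck_on_diff Ck_on_mult Ck_on_inner Ck_on_const
        Ck_on_linear [OF _ bounded_linear_snd] lin open_V)
  ultimately show ?case ..
qed

text \<open>This is the Laplacian of r^p with p = -2m in dimension n + 1, where r^2 is Q. The
  \<open>J (m + 2)\<close> terms of the axial and the vector directions cancel.\<close>

lemma laplacian_J:
  assumes "x \<in> V"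
  shows "laplacian (\<lambda>x. c *\<^sub>R J m x) x
    = (c * (2 * real m * (2 * real m + 1 - real CARD('n)))) *\<^sub>R J (Suc m) x"
proof -
  let ?r = "snd x \<bullet> snd x"
  have "laplacian (\<lambda>x. c *\<^sub>R J m x) x
    = (c * (2 * real m)) *\<^sub>R ((2 * real m + 1) *\<^sub>R J (Suc m) x - (2 * real (Suc m) * ?r) *\<^sub>R J (m + 2) x)
    + (\<Sum>j\<in>UNIV. (c * (- 2 * real m)) *\<^sub>R (J (Suc m) x
        - (2 * real (Suc m)) *\<^sub>R ((snd x $ j * snd x $ j) *\<^sub>R J (m + 2) x)))"
  proof (rule laplacian_eqI [OF open_V assms])
    show "has_partial (1, 0) (\<lambda>x. c *\<^sub>R J m x) ((c * (2 * real m)) *\<^sub>R N (Suc m) y) y" if "y \<in> V" for y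
      using has_partial_scaleR_const [OF has_partial_J [OF that, of "(1, 0)" m], of c] by simp
    show "has_partial (1, 0) (\<lambda>y. (c * (2 * real m)) *\<^sub>R N (Suc m) y)
      ((c * (2 * real m)) *\<^sub>R ((2 * real m + 1) *\<^sub>R J (Suc m) x - (2 * real (Suc m) * ?r) *\<^sub>R J (m + 2) x)) x"
      using has_partial_scaleR_const [OF has_partial_N [OF assms, of "(1, 0)" "Suc m"], of "c * (2 * real m)"]
      by (simp add: algebra_simps)
    show "has_partial (0, axis j 1) (\<lambda>x. c *\<^sub>R J m x)
        ((c * (- 2 * real m)) *\<^sub>R ((snd y \<bullet> axis j 1) *\<^sub>R J (Suc m) y)) y" if "y \<in> V" for j y
      using has_partial_scaleR_const [OF has_partial_J [OF that, of "(0, axis j 1)" m], of c]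
      by (simp add: mult.assoc)
    show "has_partial (0, axis j 1) (\<lambda>y. (c * (- 2 * real m)) *\<^sub>R ((snd y \<bullet> axis j 1) *\<^sub>R J (Suc m) y))
      ((c * (- 2 * real m)) *\<^sub>R (J (Suc m) x - (2 * real (Suc m)) *\<^sub>R ((snd x $ j * snd x $ j) *\<^sub>R J (m + 2) x))) x"
      for j
      using has_partial_scaleR_const [OF has_partial_scaleR
          [OF has_partial_inner_snd [of "(0, axis j 1)" "axis j 1"] has_partial_J [OF assms]],
          of "c * (- 2 * real m)" "Suc m"]
      by (simp add: inner_axis inner_axis_axis algebra_simps)
  qed
  also have "(\<Sum>j\<in>UNIV. (c * (- 2 * real m)) *\<^sub>R (J (Suc m) x
        - (2 * real (Suc m)) *\<^sub>R ((snd x $ j * snd x $ j) *\<^sub>R J (m + 2) x)))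
    = (c * (- 2 * real m)) *\<^sub>R (real CARD('n) *\<^sub>R J (Suc m) x - (2 * real (Suc m)) *\<^sub>R (?r *\<^sub>R J (m + 2) x))"
    by (simp only: sum_subtractf sum_constant_scaleR sum_scaleR_nth_sq flip: scaleR_sum_right)
  finally show ?thesis by (simp add: algebra_simps)
qed

text \<open>Stands for (s - conj x) Q^(-m), with conj x the conjugate paravector; index 1 is the
  left slice Cauchy kernel.\<close>

definition S :: "nat \<Rightarrow> 'n paravector \<Rightarrow> 'n clifford" where
  "S m x = N m x + vec1 (snd x) * J m x"

lemma has_partial_S:
  assumes "x \<in> V"
  shows "has_partial b (S m)
    (fst b *\<^sub>R ((2 * real m - 1) *\<^sub>R J m x - (2 * real m * (snd x \<bullet> snd x)) *\<^sub>R J (Suc m) x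
        + (2 * real m) *\<^sub>R (vec1 (snd x) * N (Suc m) x))
      - (2 * real m * (snd x \<bullet> snd b)) *\<^sub>R S (Suc m) x + vec1 (snd b) * J m x) x"
  using has_partial_add [OF has_partial_N [OF assms, of b m]
      has_partial_mult [OF has_partial_vec1_snd has_partial_J [OF assms, of b m]]]
  unfolding S_def [abs_def] by (simp add: algebra_simps)

text \<open>The \<open>S (m + 2)\<close> terms cancel as for \<open>J\<close>. The axial direction
  leaves coefficients 2m(2m - 1) on \<open>N\<close> and 2m(2m + 1) on the vector term; the cross
  derivatives add -4m to the latter, so both agree and \<open>S\<close> reappears.\<close>

lemma laplacian_S:
  assumes "x \<in> V"
  shows "laplacian (\<lambda>x. c *\<^sub>R S m x) x
    = (c * (2 * real m * (2 * real m - 1 - real CARD('n)))) *\<^sub>R S (Suc m) x"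
proof -
  let ?r = "snd x \<bullet> snd x" and ?e = "vec1 (snd x)"
  let ?p = "\<lambda>y. c *\<^sub>R ((2 * real m - 1) *\<^sub>R J m y - (2 * real m) *\<^sub>R ((snd y \<bullet> snd y) *\<^sub>R J (Suc m) y)
        + (2 * real m) *\<^sub>R (vec1 (snd y) * N (Suc m) y))"
  let ?a = "c *\<^sub>R ((2 * real m - 1) *\<^sub>R ((2 * real m) *\<^sub>R N (Suc m) x)
        - (2 * real m) *\<^sub>R (?r *\<^sub>R ((2 * real (Suc m)) *\<^sub>R N (m + 2) x))
        + (2 * real m) *\<^sub>R (?e * ((2 * real m + 1) *\<^sub>R J (Suc m) x - (2 * real (Suc m) * ?r) *\<^sub>R J (m + 2) x)))"
  let ?q = "\<lambda>j y. c *\<^sub>R (cgen j * J m y - (2 * real m) *\<^sub>R ((snd y \<bullet> axis j 1) *\<^sub>R S (Suc m) y))"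
  let ?b = "\<lambda>j. c *\<^sub>R ((4 * real m * real (Suc m)) *\<^sub>R ((snd x $ j * snd x $ j) *\<^sub>R S (m + 2) x)
        - (2 * real m) *\<^sub>R S (Suc m) x - (4 * real m) *\<^sub>R ((snd x $ j) *\<^sub>R (cgen j * J (Suc m) x)))"
  \<comment> \<open>The cross term with coefficient 4m arises in two halves, from
    \<open>cgen j * J m\<close> and from the vector factor inside \<open>S (Suc m)\<close>; the
    coefficient is split to match them.\<close>
  have double: "(4 * r) *\<^sub>R y = (2 * r) *\<^sub>R y + (2 * r) *\<^sub>R y" for r and y :: "'n clifford"
    by (simp flip: scaleR_add_left)
  have "laplacian (\<lambda>x. c *\<^sub>R S m x) x = ?a + (\<Sum>j\<in>UNIV. ?b j)"
  proof (rule laplacian_eqI [OF open_V assms])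
    show "has_partial (1, 0) (\<lambda>x. c *\<^sub>R S m x) (?p y) y" if "y \<in> V" for y
      using has_partial_scaleR_const [OF has_partial_S [OF that, of "(1, 0)" m], of c]
      by (simp add: linear_0 [OF linear_vec1])
    show "has_partial (1, 0) ?p ?a x"
      using has_partial_scaleR_const [OF has_partial_add [OF has_partial_diff
          [OF has_partial_scaleR_const [OF has_partial_J [OF assms, of "(1, 0)" m], of "2 * real m - 1"]
            has_partial_scaleR_const [OF has_partial_scaleR [OF has_partial_snd_norm_sq
                has_partial_J [OF assms, of "(1, 0)" "Suc m"]], of "2 * real m"]]
          has_partial_scaleR_const [OF has_partial_mult [OF has_partial_vec1_snd
                has_partial_N [OF assms, of "(1, 0)" "Suc m"]], of "2 * real m"]], of c]
      by (simp add: linear_0 [OF linear_vec1] add.commute)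
    show "has_partial (0, axis j 1) (\<lambda>x. c *\<^sub>R S m x) (?q j y) y" if "y \<in> V" for j y
      using has_partial_scaleR_const [OF has_partial_S [OF that, of "(0, axis j 1)" m], of c]
      by (simp add: vec1_axis)
    show "has_partial (0, axis j 1) (?q j) (?b j) x" for j
      using has_partial_scaleR_const [OF has_partial_diff
          [OF has_partial_bounded_linear [OF bounded_bilinear.bounded_linear_right
              [OF bounded_bilinear_clifford_mult]
              has_partial_J [OF assms, of "(0, axis j 1)" m], of "cgen j"]
            has_partial_scaleR_const [OF has_partial_scaleR
              [OF has_partial_inner_snd [of "(0, axis j 1)" "axis j 1"]
                has_partial_S [OF assms, of _ "Suc m"]], of "2 * real m"]], of c]
      unfolding double by (simp add: vec1_axis inner_axis inner_axis_axis algebra_simps)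
  qed
  also have "?a + (\<Sum>j\<in>UNIV. ?b j) = ?a + c *\<^sub>R ((4 * real m * real (Suc m)) *\<^sub>R (?r *\<^sub>R S (m + 2) x)
        - real CARD('n) *\<^sub>R ((2 * real m) *\<^sub>R S (Suc m) x) - (4 * real m) *\<^sub>R (?e * J (Suc m) x))"
    by (simp only: sum_subtractf sum_constant_scaleR sum_scaleR_nth_sq sum_nth_cgen_mult
        flip: scaleR_sum_right)
  finally have eq: "laplacian (\<lambda>x. c *\<^sub>R S m x) x = \<dots>" .
  show ?thesis
    unfolding eq
    unfolding clifford_eq_iff S_def coord_simps distrib_left right_diff_distrib mult_scaleR_right of_nat_Suc
    by (simp add: algebra_simps)
qed

text \<open>The squares of the generators give -n \<open>J m\<close>. The remaining term -2m x_
  \<open>S (Suc m)\<close> expands, by x_ x_ = -|x_|^2, into the negative of what the axial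
  derivative adds to (2m - 1) \<open>J m\<close>.\<close>

lemma dirac_left_S:
  assumes "x \<in> V"
  shows "dirac_left (\<lambda>x. c *\<^sub>R S m x) x = (c * (2 * real m - 1 - real CARD('n))) *\<^sub>R J m x"
proof -
  note p = partial_eqI [OF has_partial_scaleR_const [OF has_partial_S [OF assms]]]
  have *: "vec1 (snd x) * (vec1 (snd x) * a) = - ((snd x \<bullet> snd x) *\<^sub>R a)" for a
    by (simp add: vec1_mult_self flip: mult.assoc)
  let ?sum = "\<Sum>j\<in>UNIV. cgen j * partial (0, axis j 1) (\<lambda>x. c *\<^sub>R S m x) x"
  have "?sum = (\<Sum>j\<in>UNIV. c *\<^sub>R (- J m x - (2 * real m) *\<^sub>R ((snd x $ j) *\<^sub>R (cgen j * S (Suc m) x))))"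
    by (simp add: p vec1_axis inner_axis algebra_simps cgen_mult_cgen_mult)
  also have "\<dots> = c *\<^sub>R (real CARD('n) *\<^sub>R (- J m x) - (2 * real m) *\<^sub>R (vec1 (snd x) * S (Suc m) x))"
    by (simp only: sum_subtractf sum_constant_scaleR sum_nth_cgen_mult flip: scaleR_sum_right)
  finally have eq: "?sum = \<dots>" .
  show ?thesis
    unfolding dirac_left_def unfolding eq unfolding p
    by (simp add: linear_0 [OF linear_vec1] S_def algebra_simps *)
qed

text \<open>Mirror image of the left computation, with the vector to the right of \<open>J\<close>.
  On this side the Dirac operator meets f before any Laplacian, so no accumulated scalar stands in
  front.\<close>

lemma dirac_right_S:
  assumes "x \<in> V"
  shows "dirac_right (\<lambda>x. N m x + J m x * vec1 (snd x)) x
    = (2 * real m - 1 - real CARD('n)) *\<^sub>R J m x"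
proof -
  note p = partial_eqI [OF has_partial_add [OF has_partial_N [OF assms, of _ m]
      has_partial_mult [OF has_partial_J [OF assms, of _ m] has_partial_vec1_snd]]]
  let ?S = "N (Suc m) x + J (Suc m) x * vec1 (snd x)"
  have *: "(\<Sum>j\<in>UNIV. (snd x $ j) *\<^sub>R (a * cgen j)) = a * vec1 (snd x)" for a
    by (simp add: vec1_def sum_distrib_left)
  let ?sum = "\<Sum>j\<in>UNIV. partial (0, axis j 1) (\<lambda>x. N m x + J m x * vec1 (snd x)) x * cgen j"
  have "?sum = (\<Sum>j\<in>UNIV. - J m x - (2 * real m) *\<^sub>R ((snd x $ j) *\<^sub>R (?S * cgen j)))"
    by (simp add: p vec1_axis inner_axis algebra_simps cgen_mult_self)
  also have "\<dots> = real CARD('n) *\<^sub>R (- J m x) - (2 * real m) *\<^sub>R (?S * vec1 (snd x))"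
    by (simp only: sum_subtractf sum_constant_scaleR * flip: scaleR_sum_right)
  finally have eq: "?sum = \<dots>" .
  show ?thesis
    unfolding dirac_right_def unfolding eq unfolding p
    by (simp add: linear_0 [OF linear_vec1] algebra_simps vec1_mult_self)
qed

end

section \<open>Kernels given by integrals over a curve\<close>

text \<open>The squared distance in R^(n+1) from \<open>x\<close> to the axis point
  \<open>s\<close>, continued to complex \<open>s\<close>.\<close>

definition quad :: "complex \<Rightarrow> 'n::finite paravector \<Rightarrow> complex" where
  "quad s x = (s - of_real (fst x))\<^sup>2 + of_real (snd x \<bullet> snd x)"

lemma has_partial_sum:
  "finite I \<Longrightarrow> (\<And>i. i \<in> I \<Longrightarrow> has_partial b (f i) (d i) x) \<Longrightarrow>
    has_partial b (\<lambda>x. \<Sum>i\<in>I. f i x) (\<Sum>i\<in>I. d i) x"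
  unfolding has_partial_def by (rule has_vector_derivative_sum)

locale cauchy_kernels =
  fixes V :: "'n::{finite,linorder} paravector set" and s :: "real \<Rightarrow> complex"
  assumes open_V: "open V"
    and continuous_s: "continuous_on {0..1} s"
    and quad_nonzero: "x \<in> V \<Longrightarrow> t \<in> {0..1} \<Longrightarrow> quad (s t) x \<noteq> 0"
begin

text \<open>\<open>g\<close> collects the holomorphic function and the speed of the curve. It does
  not depend on \<open>x\<close>, so differentiation touches only the power of
  \<open>quad\<close>.\<close>

definition I :: "(real \<Rightarrow> complex) \<Rightarrow> nat \<Rightarrow> 'n paravector \<Rightarrow> complex" where
  "I g m x = integral {0..1} (\<lambda>t. g t * inverse (quad (s t) x) ^ m)"

lemma continuous_on_kernel:
  assumes "continuous_on {0..1} g"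
  shows "continuous_on (V \<times> cbox 0 1) (\<lambda>(x, t). g t * inverse (quad (s t) x) ^ m)"
proof -
  have "continuous_on (V \<times> {0..1}) (\<lambda>p. g (snd p))" "continuous_on (V \<times> {0..1}) (\<lambda>p. s (snd p))"
    by (auto intro!: continuous_on_compose2 [OF assms] continuous_on_compose2 [OF continuous_s]
        continuous_intros)
  with quad_nonzero show ?thesis
    by (auto simp: split_beta quad_def intro!: continuous_intros)
qed

lemma continuous_on_kernel':
  assumes "continuous_on {0..1} g" "x \<in> V"
  shows "continuous_on {0..1} (\<lambda>t. g t * inverse (quad (s t) x) ^ m)"
  using assms quad_nonzero [OF assms(2)]
  by (auto simp: quad_def intro!: continuous_intros continuous_s)

lemma integrable_kernel:
  assumes "continuous_on {0..1} g" "x \<in> V"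
  shows "(\<lambda>t. g t * inverse (quad (s t) x) ^ m) integrable_on {0..1}"
  by (rule integrable_continuous_real [OF continuous_on_kernel' [OF assms]])

lemma continuous_on_I:
  assumes "continuous_on {0..1} g"
  shows "continuous_on V (I g m)"
  using integral_continuous_on_param [OF continuous_on_kernel [OF assms]]
  by (simp add: I_def [abs_def])

text \<open>Insert \<open>quad\<close> times its inverse and expand \<open>quad\<close> in powers of
  \<open>s\<close>. This trades the second moment for lower ones, which keeps the derivatives of
  \<open>N\<close> inside the family.\<close>

lemma I_Suc:
  assumes "continuous_on {0..1} g" "x \<in> V"
  shows "I g m x = I (\<lambda>t. s t * (s t * g t)) (Suc m) x - 2 * of_real (fst x) * I (\<lambda>t. s t * g t) (Suc m) x
    + of_real ((fst x)\<^sup>2 + snd x \<bullet> snd x) * I g (Suc m) x"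
proof -
  let ?k = "\<lambda>g t. g t * inverse (quad (s t) x) ^ Suc m"
  let ?g1 = "\<lambda>t. s t * g t" and ?g2 = "\<lambda>t. s t * (s t * g t)"
  have c: "continuous_on {0..1} ?g1" "continuous_on {0..1} ?g2"
    by (auto intro!: continuous_intros continuous_s assms)
  have "g t * inverse (quad (s t) x) ^ m
      = ?k ?g2 t - 2 * of_real (fst x) * ?k ?g1 t + of_real ((fst x)\<^sup>2 + snd x \<bullet> snd x) * ?k g t"
    if "t \<in> {0..1}" for t
  proof -
    have "g t * inverse (quad (s t) x) ^ m = quad (s t) x * ?k g t"
      using quad_nonzero [OF assms(2) that] by simp
    then show ?thesis
      by (simp add: quad_def power2_eq_square algebra_simps)
  qed
  then have "I g m x = integral {0..1} (\<lambda>t. ?k ?g2 t - 2 * of_real (fst x) * ?k ?g1 t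
      + of_real ((fst x)\<^sup>2 + snd x \<bullet> snd x) * ?k g t)"
    unfolding I_def by (rule integral_cong)
  also have "\<dots> = I ?g2 (Suc m) x - 2 * of_real (fst x) * I ?g1 (Suc m) x
    + of_real ((fst x)\<^sup>2 + snd x \<bullet> snd x) * I g (Suc m) x"
    unfolding I_def
    by (subst integral_add integral_diff integral_mult_right;
        (intro integrable_diff integrable_on_mult_right integrable_kernel c assms)?)+ simp
  finally show ?thesis .
qed

lemma has_partial_I:
  assumes g: "continuous_on {0..1} g" and x: "x \<in> V"
  shows "has_partial b (I g m)
    (2 * of_nat m * (of_real (fst b) * (I (\<lambda>t. s t * g t) (Suc m) x - of_real (fst x) * I g (Suc m) x)
      - of_real (snd x \<bullet> snd b) * I g (Suc m) x)) x"
proof -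
  \<comment> \<open>The Leibniz rule needs a convex set of line parameters on which the points stay
    in \<open>V\<close>; \<open>ball 0 d\<close> is such a set.\<close>
  obtain d where d: "d > 0" "\<And>t. t \<in> ball 0 d \<Longrightarrow> x + t *\<^sub>R b \<in> V"
    using eventually_line [OF open_V x, of b] by (auto simp: eventually_nhds_metric dist_commute)
  let ?q = "\<lambda>h t. quad (s t) (x + h *\<^sub>R b)"
  let ?q' = "\<lambda>h t. of_real (2 * ((snd x + h *\<^sub>R snd b) \<bullet> snd b))
    - 2 * (s t - of_real (fst x + h * fst b)) * of_real (fst b) :: complex"
  let ?d = "\<lambda>h t. - of_nat m * (g t * ?q' h t * inverse (?q h t) ^ Suc m)"
  have "((\<lambda>h. integral (cbox 0 1) (\<lambda>t. g t * inverse (?q h t) ^ m))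
      has_vector_derivative integral (cbox 0 1) (?d 0)) (at 0 within ball 0 d)"
  proof (rule leibniz_rule_vector_derivative)
    fix h t :: real
    assume h: "h \<in> ball 0 d" and t: "t \<in> cbox 0 1"
    have nz: "?q h t \<noteq> 0"
      using quad_nonzero d(2) [OF h] t by simp
    have "((\<lambda>h. ?q h t) has_vector_derivative ?q' h t) (at h within ball 0 d)"
    proof -
      have u: "((\<lambda>h. s t - of_real (fst x + h * fst b)) has_vector_derivative - of_real (fst b))
          (at h within ball 0 d)"
        by (auto intro!: derivative_eq_intros)
      have v: "((\<lambda>h. snd x + h *\<^sub>R snd b) has_vector_derivative snd b) (at h within ball 0 d)"
        by (auto intro!: derivative_eq_intros)
      show ?thesis
        using has_vector_derivative_add [OF has_vector_derivative_mult [OF u u]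
            bounded_linear.has_vector_derivative [OF bounded_linear_of_real
              bounded_bilinear.has_vector_derivative [OF bounded_bilinear_inner v v]]]
        by (simp add: quad_def power2_eq_square inner_commute algebra_simps)
    qed
    \<comment> \<open>At \<open>m = 0\<close> the exponent \<open>m - 1\<close> of the power rule
      truncates, but the factor \<open>of_nat m\<close> is zero; hence the case split.\<close>
    moreover have "((\<lambda>z. inverse z ^ m) has_field_derivative - of_nat m * inverse z ^ Suc m) (at z within T)"
      if "z \<noteq> 0" for z :: complex and T
      using DERIV_power [OF DERIV_inverse [OF that], of m] by (cases m) (auto simp: algebra_simps)
    ultimately have "((\<lambda>h. inverse (?q h t) ^ m) has_vector_derivative
        ?q' h t * (- of_nat m * inverse (?q h t) ^ Suc m)) (at h within ball 0 d)"
      using field_vector_diff_chain_within nz by (fastforce simp: o_def)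
    from has_vector_derivative_mult_right [OF this, of "g t"]
    show "((\<lambda>h. g t * inverse (?q h t) ^ m) has_vector_derivative ?d h t) (at h within ball 0 d)"
      by (simp add: mult_ac)
  next
    fix h :: real
    assume "h \<in> ball 0 d"
    then show "(\<lambda>t. g t * inverse (?q h t) ^ m) integrable_on cbox 0 1"
      using integrable_kernel [OF g d(2)] by simp
  next
    have "continuous_on (ball 0 d \<times> {0..1}) (\<lambda>p. g (snd p))"
      "continuous_on (ball 0 d \<times> {0..1}) (\<lambda>p. s (snd p))"
      by (auto intro!: continuous_on_compose2 [OF g] continuous_on_compose2 [OF continuous_s]
          continuous_intros)
    moreover have "(s t - (of_real (fst x) + of_real h * of_real (fst b)))\<^sup>2
        + of_real ((snd x + h *\<^sub>R snd b) \<bullet> (snd x + h *\<^sub>R snd b)) \<noteq> 0"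
      if "h \<in> ball 0 d" "t \<in> {0..1}" for h t
      using quad_nonzero [OF d(2) that(2)] that(1) by (simp add: quad_def)
    ultimately show "continuous_on (ball 0 d \<times> cbox 0 1) (\<lambda>(h, t). ?d h t)"
      by (auto simp: split_beta quad_def intro!: continuous_intros)
  qed (use d in auto)
  then have deriv: "has_partial b (I g m) (integral {0..1} (?d 0)) x"
    using d(1) by (simp add: has_partial_def I_def at_within_open [where S = "ball 0 d"])
  have "integral {0..1} (?d 0)
    = integral {0..1} (\<lambda>t. 2 * of_nat m * of_real (fst b) * (s t * g t * inverse (quad (s t) x) ^ Suc m)
      - 2 * of_nat m * of_real (fst b * fst x + snd x \<bullet> snd b) * (g t * inverse (quad (s t) x) ^ Suc m))"
    by (intro integral_cong) (simp add: algebra_simps)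
  also have "\<dots> = 2 * of_nat m * of_real (fst b) * I (\<lambda>t. s t * g t) (Suc m) x
      - 2 * of_nat m * of_real (fst b * fst x + snd x \<bullet> snd b) * I g (Suc m) x"
    unfolding I_def
    by (subst integral_diff integral_mult_right;
        (intro integrable_on_mult_right integrable_kernel continuous_intros continuous_s assms)?)+ simp
  also have "\<dots> = 2 * of_nat m * (of_real (fst b) * (I (\<lambda>t. s t * g t) (Suc m) x
      - of_real (fst x) * I g (Suc m) x) - of_real (snd x \<bullet> snd b) * I g (Suc m) x)"
    by (simp add: algebra_simps)
  finally show ?thesis
    using deriv by simp
qed

text \<open>The complex unit of the contour never meets the Clifford units: each blade has its own
  complex density, and only real parts enter the algebra.\<close>

definition J :: "('n set \<Rightarrow> real \<Rightarrow> complex) \<Rightarrow> nat \<Rightarrow> 'n paravector \<Rightarrow> 'n clifford" where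
  "J g m x = (\<Sum>A\<in>UNIV. Re (I (g A) m x) *\<^sub>R blade A)"

text \<open>The factor s - x_0 depends on \<open>x\<close>, so it is split between two densities
  that do not.\<close>

definition N :: "('n set \<Rightarrow> real \<Rightarrow> complex) \<Rightarrow> nat \<Rightarrow> 'n paravector \<Rightarrow> 'n clifford" where
  "N g m x = J (\<lambda>A t. s t * g A t) m x - fst x *\<^sub>R J g m x"

lemma coord_J: "coord (J g m x) A = Re (I (g A) m x)"
  by (simp add: J_def)

lemma coord_N: "coord (N g m x) A = Re (I (\<lambda>t. s t * g A t) m x) - fst x * Re (I (g A) m x)"
  by (simp add: N_def coord_J)

lemma has_partial_J:
  assumes "\<And>A. continuous_on {0..1} (g A)" "x \<in> V"
  shows "has_partial b (J g m)
    ((2 * real m) *\<^sub>R (fst b *\<^sub>R N g (Suc m) x - (snd x \<bullet> snd b) *\<^sub>R J g (Suc m) x)) x"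
proof -
  have "has_partial b (J g m) (\<Sum>A\<in>UNIV. Re
      (2 * of_nat m * (of_real (fst b) * (I (\<lambda>t. s t * g A t) (Suc m) x - of_real (fst x) * I (g A) (Suc m) x)
      - of_real (snd x \<bullet> snd b) * I (g A) (Suc m) x)) *\<^sub>R blade A) x"
    unfolding J_def [abs_def]
    by (intro has_partial_sum finite has_partial_I assms
        has_partial_bounded_linear [OF bounded_linear_compose [OF bounded_linear_scaleR_left bounded_linear_Re]])
  moreover have "(\<Sum>A\<in>UNIV. Re
      (2 * of_nat m * (of_real (fst b) * (I (\<lambda>t. s t * g A t) (Suc m) x - of_real (fst x) * I (g A) (Suc m) x)
      - of_real (snd x \<bullet> snd b) * I (g A) (Suc m) x)) *\<^sub>R blade A)
    = (2 * real m) *\<^sub>R (fst b *\<^sub>R N g (Suc m) x - (snd x \<bullet> snd b) *\<^sub>R J g (Suc m) x)"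
    by (simp add: clifford_eq_iff coord_J coord_N)
  ultimately show ?thesis by simp
qed

lemma axial_kernels:
  assumes g: "\<And>A. continuous_on {0..1} (g A)"
  shows "axial_kernels V (J g) (N g)"
proof
  let ?g1 = "\<lambda>A t. s t * g A t"
  have g1: "continuous_on {0..1} (?g1 A)" for A
    by (intro continuous_intros continuous_s g)
  have J: "continuous_on V (J g m)" if "\<And>A. continuous_on {0..1} (g A)" for g m
    unfolding J_def [abs_def] by (intro continuous_intros continuous_on_I that)
  show "open V" by (rule open_V)
  show "continuous_on V (J g m)" for m by (rule J [OF g])
  show "continuous_on V (N g m)" for m
    unfolding N_def [abs_def] by (intro continuous_intros J g g1)
  show "has_partial b (J g m)
      ((2 * real m) *\<^sub>R (fst b *\<^sub>R N g (Suc m) x - (snd x \<bullet> snd b) *\<^sub>R J g (Suc m) x)) x"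
    if "x \<in> V" for x b m
    by (rule has_partial_J [OF g that])
  show "has_partial b (N g m)
      (fst b *\<^sub>R ((2 * real m - 1) *\<^sub>R J g m x - (2 * real m * (snd x \<bullet> snd x)) *\<^sub>R J g (Suc m) x)
        - (2 * real m * (snd x \<bullet> snd b)) *\<^sub>R N g (Suc m) x) x" (is "has_partial _ _ ?d _")
    if "x \<in> V" for x b m
  proof -
    have "coord (J g m x) A = coord (J (\<lambda>A t. s t * (s t * g A t)) (Suc m) x) A
        - 2 * fst x * coord (J ?g1 (Suc m) x) A + ((fst x)\<^sup>2 + snd x \<bullet> snd x) * coord (J g (Suc m) x) A" for A
      using I_Suc [OF g that, of A m] by (simp add: coord_J)
    note eq = this
    \<comment> \<open>Differentiating \<open>N\<close> produces the second moment, hidden in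
      \<open>N ?g1\<close>; \<open>eq\<close> removes it coordinate by coordinate.\<close>
    have "(2 * real m) *\<^sub>R (fst b *\<^sub>R N ?g1 (Suc m) x - (snd x \<bullet> snd b) *\<^sub>R J ?g1 (Suc m) x)
      - (fst x *\<^sub>R ((2 * real m) *\<^sub>R (fst b *\<^sub>R N g (Suc m) x - (snd x \<bullet> snd b) *\<^sub>R J g (Suc m) x))
        + fst b *\<^sub>R J g m x) = ?d" (is "?l = _")
      unfolding clifford_eq_iff
    proof
      fix A
      show "coord ?l A = coord ?d A"
        using eq [of A] unfolding N_def coord_simps power2_eq_square by algebra
    qed
    moreover have "has_partial b (N g m)
      ((2 * real m) *\<^sub>R (fst b *\<^sub>R N ?g1 (Suc m) x - (snd x \<bullet> snd b) *\<^sub>R J ?g1 (Suc m) x)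
      - (fst x *\<^sub>R ((2 * real m) *\<^sub>R (fst b *\<^sub>R N g (Suc m) x - (snd x \<bullet> snd b) *\<^sub>R J g (Suc m) x))
        + fst b *\<^sub>R J g m x)) x"
      unfolding N_def [of g m, abs_def]
      by (intro has_partial_diff has_partial_scaleR has_partial_fst has_partial_J g g1 that)
    ultimately show ?thesis by simp
  qed
qed

end

section \<open>Local representation by Cauchy's formula\<close>

lemma norm_snd_in_slice_domain:
  assumes "axially_symmetric U" "x \<in> U"
  shows "(fst x, norm (snd x)) \<in> slice_domain U"
proof -
  have "axial_sphere x \<subseteq> U"
    using assms by (simp add: axially_symmetric_def)
  then show ?thesis
    unfolding axial_sphere_def slice_domain_def by blast
qed

text \<open>Axial symmetry carries one point of the sphere to all of it, and a negative
  \<open>v\<close> is absorbed by replacing \<open>I\<close> with \<open>- I\<close>. A single unit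
  vector thus decides membership, which makes the slice domain a preimage of
  \<open>U\<close>.\<close>

lemma slice_domain_iff:
  fixes U :: "'n::finite paravector set"
  assumes "axially_symmetric U" "e \<in> sphere 0 1"
  shows "(u, v) \<in> slice_domain U \<longleftrightarrow> (u, v *\<^sub>R e) \<in> U"
proof
  assume "(u, v *\<^sub>R e) \<in> U"
  then have U: "(u, \<bar>v\<bar> *\<^sub>R I) \<in> U" if "I \<in> sphere 0 1" for I
    using assms that by (fastforce simp: axially_symmetric_def axial_sphere_def)
  have "(u, v *\<^sub>R I) \<in> U" if "I \<in> sphere 0 1" for I
    using U [of I] U [of "- I"] that by (cases "v \<ge> 0") auto
  then show "(u, v) \<in> slice_domain U" by (simp add: slice_domain_def)
qed (use assms in \<open>auto simp: slice_domain_def\<close>)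

lemma open_slice_domain:
  fixes U :: "'n::finite paravector set"
  assumes "axially_symmetric U" "open U"
  shows "open (slice_domain U)"
proof -
  obtain e :: "real ^ 'n" where e: "norm e = 1"
    using vector_choose_size [of 1] by auto
  have "slice_domain U = (\<lambda>p. (fst p, snd p *\<^sub>R e)) -` U"
    using slice_domain_iff [OF assms(1), of e] e by auto
  moreover have "continuous_on UNIV (\<lambda>p. (fst p, snd p *\<^sub>R e) :: 'n paravector)"
    by (intro continuous_intros)
  ultimately show ?thesis
    using open_vimage [OF assms(2)] by simp
qed

definition slice_component ::
  "(real \<times> real \<Rightarrow> 'n clifford) \<Rightarrow> (real \<times> real \<Rightarrow> 'n clifford) \<Rightarrow> 'n::finite set \<Rightarrow> complex \<Rightarrow> complex"
  where
  "slice_component \<alpha> \<beta> A z = Complex (coord (\<alpha> (Re z, Im z)) A) (coord (\<beta> (Re z, Im z)) A)"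

lemma partial_has_derivative:
  assumes "(f has_derivative f') (at x)"
  shows "partial b f x = f' b"
proof -
  have "((\<lambda>t. x + t *\<^sub>R b) has_derivative (\<lambda>t. t *\<^sub>R b)) (at (0::real))"
    by (auto intro!: derivative_eq_intros)
  then have "((\<lambda>t. f (x + t *\<^sub>R b)) has_derivative (\<lambda>t. f' (t *\<^sub>R b))) (at 0)"
    using has_derivative_compose [of "\<lambda>t. x + t *\<^sub>R b" _ 0 UNIV f f'] assms by simp
  then have "((\<lambda>t. f (x + t *\<^sub>R b)) has_vector_derivative f' b) (at 0)"
    by (simp add: has_vector_derivative_def linear_simps [OF has_derivative_bounded_linear [OF assms]])
  then show ?thesis
    unfolding partial_def by (rule vector_derivative_at)
qed

text \<open>In each coordinate the system for \<alpha> and \<beta> is the Cauchy-Riemann system, so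
  the real derivative is multiplication by a complex number. All further regularity comes from
  Cauchy's formula.\<close>

lemma holomorphic_slice_component:
  fixes U :: "'n::finite paravector set"
  assumes "open (slice_domain U)" "slice_pair U \<alpha> \<beta>"
  shows "slice_component \<alpha> \<beta> A holomorphic_on {z. (Re z, Im z) \<in> slice_domain U}"
proof -
  have "slice_component \<alpha> \<beta> A field_differentiable (at z)" if z: "(Re z, Im z) \<in> slice_domain U" for z
  proof -
    let ?p = "(Re z, Im z)"
    have "\<alpha> differentiable (at ?p)" "\<beta> differentiable (at ?p)"
      using assms z by (auto simp: slice_pair_def differentiable_on_eq_differentiable_at)
    then obtain a b where ab: "(\<alpha> has_derivative a) (at ?p)" "(\<beta> has_derivative b) (at ?p)"
      by (auto simp: differentiable_def)
    have lin: "linear a" "linear b"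
      using ab has_derivative_linear by auto
    have cr: "a (1, 0) = b (0, 1)" "a (0, 1) = - b (1, 0)"
      using assms(2) z unfolding slice_pair_def by (force simp: partial_has_derivative [OF ab(1)]
          partial_has_derivative [OF ab(2)])+
    have coord: "bounded_linear (\<lambda>x :: 'n clifford. coord x A)"
      unfolding linear_conv_bounded_linear [symmetric] by (intro linearI) simp_all
    have ReIm: "((\<lambda>w. (Re w, Im w)) has_derivative (\<lambda>w. (Re w, Im w))) (at z)"
      by (auto intro!: derivative_eq_intros)
    have a': "((\<lambda>w. coord (\<alpha> (Re w, Im w)) A) has_derivative (\<lambda>w. coord (a (Re w, Im w)) A)) (at z)"
      using bounded_linear.has_derivative [OF coord has_derivative_compose [OF ReIm, of \<alpha> a]] ab(1) by simp
    have b': "((\<lambda>w. coord (\<beta> (Re w, Im w)) A) has_derivative (\<lambda>w. coord (b (Re w, Im w)) A)) (at z)"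
      using bounded_linear.has_derivative [OF coord has_derivative_compose [OF ReIm, of \<beta> b]] ab(2) by simp
    have split: "a (u, v) = u *\<^sub>R a (1, 0) + v *\<^sub>R a (0, 1)" "b (u, v) = u *\<^sub>R b (1, 0) + v *\<^sub>R b (0, 1)"
      for u v :: real
      unfolding linear_cmul [OF lin(1), symmetric] linear_add [OF lin(1), symmetric]
        linear_cmul [OF lin(2), symmetric] linear_add [OF lin(2), symmetric] by simp_all
    have "(slice_component \<alpha> \<beta> A has_derivative
        (\<lambda>w. of_real (coord (a (Re w, Im w)) A) + \<i> * of_real (coord (b (Re w, Im w)) A))) (at z)"
      unfolding slice_component_def [abs_def] Complex_eq
      by (intro has_derivative_add has_derivative_of_real a' b' has_derivative_mult_right)
    moreover have "of_real (coord (a (Re w, Im w)) A) + \<i> * of_real (coord (b (Re w, Im w)) A)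
        = Complex (coord (a (1, 0)) A) (coord (b (1, 0)) A) * w" for w
      unfolding split [of "Re w"] cr by (simp add: complex_eq_iff)
    ultimately have "(slice_component \<alpha> \<beta> A has_field_derivative
        Complex (coord (a (1, 0)) A) (coord (b (1, 0)) A)) (at z)"
      by (simp add: has_field_derivative_def)
    then show ?thesis
      by (auto simp: field_differentiable_def)
  qed
  then show ?thesis
    by (auto simp: holomorphic_on_def intro: field_differentiable_at_within)
qed

text \<open>Around a real centre both \<open>w\<close> and its conjugate lie inside the circle; off the axis only \<open>w\<close>
  does, and the factor \<open>\<kappa> = 2\<close> makes up for the missing half.\<close>

lemma Cauchy_integral_conjugate_pair:
  assumes F: "F holomorphic_on cball z R" and w: "norm (w - z) < R"
    and \<kappa>: "\<kappa> = 1 \<and> Im z = 0 \<and> F (cnj w) = cnj (F w) \<or> \<kappa> = 2 \<and> R < Im z \<and> Im w \<ge> 0"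
    and q: "\<And>t. t \<in> {0..1} \<Longrightarrow> circlepath z R t \<noteq> w \<and> circlepath z R t \<noteq> cnj w"
  defines "g \<equiv> \<lambda>t. of_real (\<kappa> * R) * exp (2 * of_real pi * \<i> * of_real t) * F (circlepath z R t)"
    and "q \<equiv> \<lambda>t. (circlepath z R t - w) * (circlepath z R t - cnj w)"
  shows "Re (integral {0..1} (\<lambda>t. g t * (circlepath z R t - of_real (Re w)) * inverse (q t))) = Re (F w)"
    and "Im w * Re (integral {0..1} (\<lambda>t. g t * inverse (q t))) = Im (F w)"
proof -
  \<comment> \<open>Value of the Cauchy integral at \<open>cnj w\<close>: the reflected value when
    the centre is real, zero when the disc lies above the axis.\<close>
  define c where "c = (if Im z = 0 then cnj (F w) else 0)"
  let ?\<gamma> = "circlepath z R"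
  have R: "R > 0" using w norm_ge_zero le_less_trans by blast
  have 1: "((\<lambda>u. F u / (u - w)) has_contour_integral (2 * of_real pi * \<i> * F w)) ?\<gamma>"
    by (rule Cauchy_integral_circlepath_simple [OF F w])
  have 2: "((\<lambda>u. F u / (u - cnj w)) has_contour_integral (2 * of_real pi * \<i> * c)) ?\<gamma>"
  proof (cases "Im z = 0")
    case True
    then have "cnj w - z = cnj (w - z)" by (simp add: complex_eq_iff)
    then have "norm (cnj w - z) < R" using w by (metis complex_mod_cnj)
    from Cauchy_integral_circlepath_simple [OF F this] show ?thesis
      using \<kappa> True R by (auto simp: c_def)
  next
    case False
    then have "R < Im z" "Im w \<ge> 0" using \<kappa> by auto
    have "u \<noteq> cnj w" if "u \<in> cball z R" for u
    proof
      assume "u = cnj w"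
      then have "Im z - Im u \<ge> Im z" using \<open>Im w \<ge> 0\<close> by simp
      moreover have "\<bar>Im (z - u)\<bar> \<le> R"
        using that abs_Im_le_cmod [of "z - u"] by (simp add: dist_norm)
      ultimately show False using \<open>R < Im z\<close> by simp
    qed
    then have "(\<lambda>u. F u / (u - cnj w)) holomorphic_on cball z R"
      by (intro holomorphic_intros F) auto
    then have "((\<lambda>u. F u / (u - cnj w)) has_contour_integral 0) ?\<gamma>"
      by (rule Cauchy_theorem_convex_simple) (use R in \<open>auto simp: path_image_circlepath sphere_def\<close>)
    with False show ?thesis by (simp add: c_def)
  qed
  have int: "((\<lambda>t. F (?\<gamma> t) / (?\<gamma> t - w) * (of_real R * exp (2 * of_real pi * \<i> * of_real t)))
      has_integral F w) {0..1}"
    "((\<lambda>t. F (?\<gamma> t) / (?\<gamma> t - cnj w) * (of_real R * exp (2 * of_real pi * \<i> * of_real t)))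
      has_integral c) {0..1}"
  proof -
    \<comment> \<open>The speed of the circle is 2 pi i R exp(2 pi i t); dividing by 2 pi i leaves
      the density built into \<open>g\<close>.\<close>
    have *: "((\<lambda>t. f (?\<gamma> t) * (of_real R * exp (2 * of_real pi * \<i> * of_real t))) has_integral b) {0..1}"
      if "(f has_contour_integral (2 * of_real pi * \<i> * b)) ?\<gamma>" for f b
    proof -
      have "((\<lambda>t. f (?\<gamma> t) * (2 * of_real pi * \<i> * of_real R * exp (2 * of_real pi * \<i> * of_real t)))
          has_integral 2 * of_real pi * \<i> * b) {0..1}"
        using that unfolding has_contour_integral_def
        by (rule has_integral_eq [rotated]) (simp add: vector_derivative_circlepath01)
      from has_integral_mult_right [OF this, of "1 / (2 * of_real pi * \<i>)"] show ?thesis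
        by (simp add: field_simps)
    qed
    show "((\<lambda>t. F (?\<gamma> t) / (?\<gamma> t - w) * (of_real R * exp (2 * of_real pi * \<i> * of_real t)))
        has_integral F w) {0..1}" by (rule * [OF 1])
    show "((\<lambda>t. F (?\<gamma> t) / (?\<gamma> t - cnj w) * (of_real R * exp (2 * of_real pi * \<i> * of_real t)))
        has_integral c) {0..1}" by (rule * [OF 2])
  qed
  have w_cnj: "w + cnj w = 2 * of_real (Re w)" "w - cnj w = 2 * \<i> * of_real (Im w)"
    by (auto simp: complex_eq_iff)
  have "((\<lambda>t. g t * (?\<gamma> t - of_real (Re w)) * inverse (q t)) has_integral (of_real \<kappa> / 2 * (F w + c))) {0..1}"
  proof (rule has_integral_eq [OF _ has_integral_mult_right [OF has_integral_add [OF int]]])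
    fix t :: real assume "t \<in> {0..1}"
    note nz = q [OF this]
    \<comment> \<open>As half the sum of the two linear factors, the numerator splits the kernel
      into the mean of the Cauchy kernels at \<open>w\<close> and \<open>cnj w\<close>. The half
      difference does the same for \<open>Im w\<close> below.\<close>
    have "2 * of_real (Re w) = w + cnj w" using w_cnj by simp
    then have re: "?\<gamma> t - of_real (Re w) = ((?\<gamma> t - w) + (?\<gamma> t - cnj w)) / 2"
      by (simp add: field_simps)
    have *: "k / 2 * (f / p * (r * e) + f / q * (r * e)) = k * r * e * f * ((p + q) / 2) * inverse (p * q)"
      if "p \<noteq> 0" "q \<noteq> 0" for k f p q r e :: complex
      using that by (simp add: field_simps)
    show "of_real \<kappa> / 2 * (F (?\<gamma> t) / (?\<gamma> t - w) * (of_real R * exp (2 * of_real pi * \<i> * of_real t))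
        + F (?\<gamma> t) / (?\<gamma> t - cnj w) * (of_real R * exp (2 * of_real pi * \<i> * of_real t)))
      = g t * (?\<gamma> t - of_real (Re w)) * inverse (q t)"
      unfolding g_def q_def re of_real_mult by (rule *) (use nz in auto)
  qed
  then have i1: "integral {0..1} (\<lambda>t. g t * (?\<gamma> t - of_real (Re w)) * inverse (q t)) = of_real \<kappa> / 2 * (F w + c)"
    by (rule integral_unique)
  \<comment> \<open>For \<kappa> = 1 the value in \<open>i1\<close> is the real number Re F(w); for
    \<kappa> = 2 it is F(w) itself. Only the real parts agree in both cases.\<close>
  show "Re (integral {0..1} (\<lambda>t. g t * (?\<gamma> t - of_real (Re w)) * inverse (q t))) = Re (F w)"
    unfolding i1 using \<kappa> R by (auto simp: c_def)
  \<comment> \<open>Keeping \<open>Im w\<close> as a factor avoids a division that would fail on the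
    real axis.\<close>
  have "((\<lambda>t. of_real (Im w) * (g t * inverse (q t))) has_integral (of_real \<kappa> / (2 * \<i>) * (F w - c))) {0..1}"
  proof (rule has_integral_eq [OF _ has_integral_mult_right [OF has_integral_diff [OF int]]])
    fix t :: real assume "t \<in> {0..1}"
    note nz = q [OF this]
    have "2 * \<i> * of_real (Im w) = w - cnj w" using w_cnj by simp
    then have im: "of_real (Im w) = ((?\<gamma> t - cnj w) - (?\<gamma> t - w)) / (2 * \<i>)"
      by (simp add: field_simps)
    have *: "k / (2 * \<i>) * (f / p * (r * e) - f / q * (r * e)) = (q - p) / (2 * \<i>) * (k * r * e * f * inverse (p * q))"
      if "p \<noteq> 0" "q \<noteq> 0" for k f p q r e :: complex
      using that by (simp add: field_simps)
    show "of_real \<kappa> / (2 * \<i>) * (F (?\<gamma> t) / (?\<gamma> t - w) * (of_real R * exp (2 * of_real pi * \<i> * of_real t))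
        - F (?\<gamma> t) / (?\<gamma> t - cnj w) * (of_real R * exp (2 * of_real pi * \<i> * of_real t)))
      = of_real (Im w) * (g t * inverse (q t))"
      unfolding g_def q_def im of_real_mult by (rule *) (use nz in auto)
  qed
  then have "integral {0..1} (\<lambda>t. of_real (Im w) * (g t * inverse (q t))) = of_real \<kappa> / (2 * \<i>) * (F w - c)"
    by (rule integral_unique)
  then have "of_real (Im w) * integral {0..1} (\<lambda>t. g t * inverse (q t)) = of_real \<kappa> / (2 * \<i>) * (F w - c)"
    by simp
  from arg_cong [OF this, of Re]
  have "Im w * Re (integral {0..1} (\<lambda>t. g t * inverse (q t))) = Re (of_real \<kappa> / (2 * \<i>) * (F w - c))"
    by simp
  also have "\<dots> = Im (F w)"
    using \<kappa> R by (auto simp: c_def Re_divide)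
  finally show "Im w * Re (integral {0..1} (\<lambda>t. g t * inverse (q t))) = Im (F w)" .
qed

lemma polar_decomposition:
  fixes v :: "real ^ 'n"
  obtains I where "I \<in> sphere 0 1" "v = norm v *\<^sub>R I"
proof (cases "v = 0")
  case True
  obtain e :: "real ^ 'n" where "norm e = 1"
    using vector_choose_size [of 1] by auto
  with True that [of e] show ?thesis by simp
next
  case False
  with that [of "v /\<^sub>R norm v"] show ?thesis by simp
qed

lemma slice_domain_norm_snd_iff:
  assumes "axially_symmetric U"
  shows "(fst x, norm (snd x)) \<in> slice_domain U \<longleftrightarrow> x \<in> U"
  by (metis assms norm_snd_in_slice_domain polar_decomposition prod.collapse slice_domain_iff)

text \<open>The parity conditions on \<alpha> and \<beta> are the reflection symmetry of the
  holomorphic function.\<close>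

lemma slice_component_cnj:
  assumes "slice_pair U \<alpha> \<beta>" "(Re z, Im z) \<in> slice_domain U"
  shows "slice_component \<alpha> \<beta> A (cnj z) = cnj (slice_component \<alpha> \<beta> A z)"
  using assms by (auto simp: slice_pair_def slice_component_def complex_eq_iff)

text \<open>The zeros in \<open>s\<close> are the slice point of \<open>x\<close> and its conjugate,
  so a contour avoiding both keeps the kernels regular.\<close>

lemma quad_factor:
  "quad s x = (s - Complex (fst x) (norm (snd x))) * (s - cnj (Complex (fst x) (norm (snd x))))"
proof -
  have "cnj (Complex u v) = of_real u - \<i> * of_real v" for u v
    by (simp add: complex_eq_iff)
  then show ?thesis
    unfolding quad_def dot_square_norm Complex_eq
    by (simp add: power2_eq_square algebra_simps)
qed

text \<open>\<open>V\<close> is cut out by a condition on \<open>fst y\<close> and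
  \<open>norm (snd y)\<close> alone, and \<open>J\<close> sees \<open>y\<close> only through
  \<open>quad\<close>. This gives the last clause, invariance over the sphere of \<open>x\<close>,
  from which the axial form follows later.\<close>

lemma local_axial_kernels:
  fixes U :: "'n::{finite,linorder} paravector set"
  assumes U: "open U" "axially_symmetric U" and \<alpha>\<beta>: "slice_pair U \<alpha> \<beta>" and x: "x \<in> U"
  obtains V J N where "axial_kernels V J N" "x \<in> V" "V \<subseteq> U"
    "\<And>y. y \<in> V \<Longrightarrow> \<alpha> (fst y, norm (snd y)) = N 1 y"
    "\<And>y. y \<in> V \<Longrightarrow> \<beta> (fst y, norm (snd y)) = norm (snd y) *\<^sub>R J 1 y"
    "\<And>y m. fst y = fst x \<Longrightarrow> norm (snd y) = norm (snd x) \<Longrightarrow> y \<in> V \<and> J m y = J m x"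
proof -
  define w where "w y = Complex (fst y) (norm (snd y))" for y :: "'n paravector"
  define \<Omega> where "\<Omega> = {z. (Re z, Im z) \<in> slice_domain U}"
  define F where "F = slice_component \<alpha> \<beta>"
  let ?z = "w x"
  note dom = open_slice_domain [OF U(2,1)]
  have "\<Omega> = (\<lambda>z. (Re z, Im z)) -` slice_domain U"
    by (auto simp: \<Omega>_def)
  then have "open \<Omega>"
    by (auto intro!: open_vimage [OF dom] continuous_intros)
  have \<Omega>_iff: "w y \<in> \<Omega> \<longleftrightarrow> y \<in> U" for y
    by (simp add: w_def \<Omega>_def slice_domain_norm_snd_iff [OF U(2)])
  obtain R\<^sub>0 where R\<^sub>0: "R\<^sub>0 > 0" "cball ?z R\<^sub>0 \<subseteq> \<Omega>"
    using \<open>open \<Omega>\<close> x \<Omega>_iff open_contains_cball by metis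
  \<comment> \<open>Off the axis, half the height keeps the closed disc in the upper half-plane,
    away from every \<open>cnj (w y)\<close>; on the axis the disc is its own mirror image.\<close>
  define R where "R = (if snd x = 0 then R\<^sub>0 else min R\<^sub>0 (norm (snd x) / 2))"
  define \<kappa> :: real where "\<kappa> = (if snd x = 0 then 1 else 2)"
  have R: "R > 0" "cball ?z R \<subseteq> \<Omega>" "snd x \<noteq> 0 \<Longrightarrow> R < Im ?z"
    using R\<^sub>0 by (auto simp: R_def w_def min_less_iff_disj)
  define V where "V = {y. norm (w y - ?z) < R}"
  have "continuous_on UNIV (\<lambda>y. norm (w y - ?z))"
    unfolding w_def Complex_eq by (intro continuous_intros)
  then have "open V"
    unfolding V_def by (rule open_Collect_less) (rule continuous_on_const)
  have V_\<Omega>: "w y \<in> \<Omega>" if "y \<in> V" for y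
    using that R(2) by (auto simp: V_def dist_norm norm_minus_commute)
  then have "V \<subseteq> U" using \<Omega>_iff by blast
  have "x \<in> V" using R(1) by (simp add: V_def)
  let ?\<gamma> = "circlepath ?z R"
  have \<gamma>: "norm (?\<gamma> t - ?z) = R" for t
    using R(1) by (simp add: circlepath norm_mult)
  then have \<gamma>_cball: "?\<gamma> t \<in> cball ?z R" for t
    by (metis dist_commute dist_norm mem_cball order_refl)
  have avoid: "?\<gamma> t \<noteq> w y \<and> ?\<gamma> t \<noteq> cnj (w y)" if "y \<in> V" for y t
  proof
    show "?\<gamma> t \<noteq> w y"
      using \<gamma> [of t] that by (auto simp: V_def)
    show "?\<gamma> t \<noteq> cnj (w y)"
    proof
      assume eq: "?\<gamma> t = cnj (w y)"
      show False
      proof (cases "snd x = 0")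
        case True
        then have "cnj (w y) - ?z = cnj (w y - ?z)"
          by (simp add: w_def complex_eq_iff)
        then have "norm (cnj (w y) - ?z) = norm (w y - ?z)"
          by (metis complex_mod_cnj)
        with \<gamma> [of t] eq that show False by (simp add: V_def)
      next
        case False
        have "\<bar>Im (?\<gamma> t - ?z)\<bar> \<le> R"
          using abs_Im_le_cmod [of "?\<gamma> t - ?z"] \<gamma> [of t] by simp
        moreover have "Im (?\<gamma> t) \<le> 0"
          unfolding eq by (simp add: w_def)
        ultimately show False
          using R(1) R(3) [OF False] minus_complex.sel(2) [of "?\<gamma> t" ?z] by linarith
      qed
    qed
  qed
  interpret cauchy_kernels V ?\<gamma>
  proof
    show "continuous_on {0..1} ?\<gamma>"
      using path_circlepath [of ?z R] by (simp add: path_def)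
    show "quad (?\<gamma> t) y \<noteq> 0" if "y \<in> V" for y t
      using avoid [OF that, of t] by (auto simp: quad_factor w_def)
  qed (rule \<open>open V\<close>)
  have F: "F A holomorphic_on cball ?z R" for A
    using holomorphic_slice_component [OF dom \<alpha>\<beta>] R(2)
    unfolding F_def \<Omega>_def by (rule holomorphic_on_subset)
  define g where "g A t = of_real (\<kappa> * R) * exp (2 * of_real pi * \<i> * of_real t) * F A (?\<gamma> t)" for A t
  have g: "continuous_on {0..1} (g A)" for A
  proof -
    have "continuous_on {0..1} (\<lambda>t. F A (?\<gamma> t))"
      by (rule continuous_on_compose2 [OF holomorphic_on_imp_continuous_on [OF F] continuous_s])
        (use \<gamma>_cball in auto)
    then show ?thesis
      unfolding g_def [abs_def] by (intro continuous_intros)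
  qed
  \<comment> \<open>The left sides are the coordinates of \<open>N g 1 y\<close> and of
    \<open>norm (snd y) *\<^sub>R J g 1 y\<close>.\<close>
  have cauchy: "Re (I (\<lambda>t. ?\<gamma> t * g A t) 1 y) - fst y * Re (I (g A) 1 y) = Re (F A (w y))"
    "norm (snd y) * Re (I (g A) 1 y) = Im (F A (w y))" if y: "y \<in> V" for y A
  proof -
    have wy: "norm (w y - ?z) < R" using y by (simp add: V_def)
    have re_im: "Re (w y) = fst y" "Im (w y) = norm (snd y)" by (simp_all add: w_def)
    have \<kappa>: "\<kappa> = 1 \<and> Im ?z = 0 \<and> F A (cnj (w y)) = cnj (F A (w y))
        \<or> \<kappa> = 2 \<and> R < Im ?z \<and> Im (w y) \<ge> 0"
      using R(3) slice_component_cnj [OF \<alpha>\<beta>, of "w y" A] V_\<Omega> [OF y]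
      by (auto simp: \<kappa>_def F_def \<Omega>_def w_def)
    note C = Cauchy_integral_conjugate_pair [OF F wy \<kappa> avoid [OF y], folded g_def]
    have q: "(?\<gamma> t - w y) * (?\<gamma> t - cnj (w y)) = quad (?\<gamma> t) y" for t
      by (simp add: quad_factor w_def)
    have "I (\<lambda>t. ?\<gamma> t * g A t) 1 y - of_real (fst y) * I (g A) 1 y
      = integral {0..1} (\<lambda>t. ?\<gamma> t * g A t * inverse (quad (?\<gamma> t) y) ^ 1
          - of_real (fst y) * (g A t * inverse (quad (?\<gamma> t) y) ^ 1))"
      unfolding I_def
      by (subst integral_diff integral_mult_right;
          (intro integrable_on_mult_right integrable_kernel continuous_intros continuous_s g y)?)+ simp
    also have "\<dots> = integral {0..1} (\<lambda>t. g A t * (?\<gamma> t - of_real (Re (w y))) * inverse (quad (?\<gamma> t) y))"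
      by (simp add: re_im algebra_simps)
    finally have "I (\<lambda>t. ?\<gamma> t * g A t) 1 y - of_real (fst y) * I (g A) 1 y = \<dots>" .
    from arg_cong [OF this, of Re]
    show "Re (I (\<lambda>t. ?\<gamma> t * g A t) 1 y) - fst y * Re (I (g A) 1 y) = Re (F A (w y))"
      using C(1) [unfolded q] by simp
    show "norm (snd y) * Re (I (g A) 1 y) = Im (F A (w y))"
      using C(2) [unfolded q re_im] by (simp add: I_def)
  qed
  have F_w: "F A (w y) = Complex (coord (\<alpha> (fst y, norm (snd y))) A) (coord (\<beta> (fst y, norm (snd y))) A)"
    for A y
    by (simp add: F_def slice_component_def w_def)
  show thesis
  proof (rule that [OF axial_kernels [OF g] \<open>x \<in> V\<close> \<open>V \<subseteq> U\<close>])
    fix y assume y: "y \<in> V"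
    show "\<alpha> (fst y, norm (snd y)) = N g 1 y"
      using cauchy(1) [OF y] by (simp add: clifford_eq_iff coord_N F_w)
    show "\<beta> (fst y, norm (snd y)) = norm (snd y) *\<^sub>R J g 1 y"
      using cauchy(2) [OF y] by (simp add: clifford_eq_iff coord_J F_w)
  next
    fix y :: "'n paravector" and m
    assume y: "fst y = fst x" "norm (snd y) = norm (snd x)"
    then have "w y = w x" "quad s y = quad s x" for s
      by (simp_all add: w_def quad_factor)
    then show "y \<in> V \<and> J g m y = J g m x"
      using R(1) by (simp add: V_def J_def I_def)
  qed
qed

section \<open>Iterated Laplacians and the polyharmonic conclusion\<close>

context axial_kernels
begin

text \<open>Only proportionality is tracked, since the constant is immaterial until a factor
  vanishes. The representation holds on all of the open \<open>V\<close>, so it survives the next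
  Laplacian.\<close>

lemma iterated_laplacian_J:
  assumes "\<And>y. y \<in> V \<Longrightarrow> g y = c *\<^sub>R J m y"
  shows "\<exists>c. \<forall>y\<in>V. (laplacian ^^ k) g y = c *\<^sub>R J (m + k) y"
proof (induction k)
  case 0
  then show ?case using assms by auto
next
  case (Suc k)
  then obtain c where "\<And>y. y \<in> V \<Longrightarrow> (laplacian ^^ k) g y = c *\<^sub>R J (m + k) y" by blast
  from laplacian_cong [OF open_V _ this] show ?case
    by (auto simp: laplacian_J intro!: exI)
qed

lemma iterated_laplacian_S:
  assumes "\<And>y. y \<in> V \<Longrightarrow> g y = S m y"
  shows "\<exists>c. \<forall>y\<in>V. (laplacian ^^ k) g y = c *\<^sub>R S (m + k) y"
proof (induction k)
  case 0
  then show ?case using assms by (auto intro!: exI [of _ 1])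
next
  case (Suc k)
  then obtain c where "\<And>y. y \<in> V \<Longrightarrow> (laplacian ^^ k) g y = c *\<^sub>R S (m + k) y" by blast
  from laplacian_cong [OF open_V _ this] show ?case
    by (auto simp: laplacian_S intro!: exI)
qed

text \<open>\<open>h - l\<close> Laplacians lead from index \<open>l\<close> to \<open>h\<close>;
  the next one carries the factor 2h + 1 - n = 0.\<close>

lemma iterated_laplacian_J_eq_0:
  assumes "\<And>y. y \<in> V \<Longrightarrow> g y = c *\<^sub>R J l y" "CARD('n) = 2 * h + 1" "l \<le> h" "x \<in> V"
  shows "(laplacian ^^ (h - l + 1)) g x = 0"
proof -
  obtain d where "\<And>y. y \<in> V \<Longrightarrow> (laplacian ^^ (h - l)) g y = d *\<^sub>R J h y"
    using iterated_laplacian_J [OF assms(1), of "h - l"] assms(3) by auto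
  from laplacian_cong [OF open_V assms(4) this] show ?thesis
    using assms(2,4) by (simp add: laplacian_J)
qed

end

text \<open>Neighbourhood, kernels and constant may vary with \<open>x\<close>. As
  \<open>J l\<close> is constant on the sphere through \<open>x\<close>, so is \<open>g\<close>; the
  axial form then has B = 0 and is of left and right type alike.\<close>

lemma axially_polyharmonic_if_local_kernels:
  fixes U :: "'n::{finite,linorder} paravector set"
  assumes U: "open U" "axially_symmetric U" and hl: "CARD('n) = 2 * h + 1" "l \<le> h"
    and local: "\<And>x. x \<in> U \<Longrightarrow> \<exists>V J N c. axial_kernels V J N \<and> x \<in> V \<and> V \<subseteq> U \<and> (\<forall>y\<in>V. g y = c *\<^sub>R J l y)
      \<and> (\<forall>y. fst y = fst x \<longrightarrow> norm (snd y) = norm (snd x) \<longrightarrow> y \<in> V \<and> J l y = J l x)"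
  shows "left_axially_polyharmonic (h - l + 1) U g" "right_axially_polyharmonic (h - l + 1) U g"
proof -
  have smooth: "Ck_on k g U" for k
  proof (rule Ck_on_locally)
    fix x assume "x \<in> U"
    then obtain V J N c where "axial_kernels V J N" and V: "x \<in> V" "V \<subseteq> U" "\<And>y. y \<in> V \<Longrightarrow> g y = c *\<^sub>R J l y"
      using local by meson
    then interpret axial_kernels V J N by simp
    show "\<exists>V. open V \<and> x \<in> V \<and> V \<subseteq> U \<and> Ck_on k g V"
      using V open_V Ck_on_JN
      by (intro exI [of _ V] conjI Ck_on_cong [OF open_V V(3)] Ck_on_scaleR Ck_on_const) auto
  qed
  have harmonic: "(laplacian ^^ (h - l + 1)) g x = 0" if x: "x \<in> U" for x
  proof -
    obtain V J N c where "axial_kernels V J N" and V: "x \<in> V" "\<And>y. y \<in> V \<Longrightarrow> g y = c *\<^sub>R J l y"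
      using local [OF x] by meson
    then interpret axial_kernels V J N by simp
    show ?thesis by (rule iterated_laplacian_J_eq_0 [OF V(2) hl V(1)])
  qed
  have radial: "g y = g x" if "x \<in> U" "fst y = fst x" "norm (snd y) = norm (snd x)" for x y
    using local [OF that(1)] that(2,3) by metis
  obtain e :: "(real, 'n) vec" where e: "norm e = 1"
    using vector_choose_size [of 1] by auto
  \<comment> \<open>\<open>g\<close> is sampled along one fixed direction; evenness holds because
    \<open>v\<close> and \<open>- v\<close> give points of the same sphere.\<close>
  define A where "A p = g (fst p, snd p *\<^sub>R e)" for p :: "real \<times> real"
  have "A (u, - v) = A (u, v)" if "(u, v) \<in> slice_domain U" for u v
    using that e slice_domain_iff [OF U(2), of e u v] unfolding A_def by (intro radial) auto
  then have "axial_pair U A (\<lambda>_. 0)"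
    by (auto simp: axial_pair_def)
  moreover have "g x = A (fst x, norm (snd x))" if "x \<in> U" for x
    using radial [OF that, of "(fst x, norm (snd x) *\<^sub>R e)"] e by (simp add: A_def)
  ultimately have "left_axial_form U g" and "right_axial_form U g"
    unfolding left_axial_form_def right_axial_form_def
    by - (rule exI [of _ A], rule exI [of _ "\<lambda>_. 0"], simp)+
  with smooth harmonic
  show "left_axially_polyharmonic (h - l + 1) U g" "right_axially_polyharmonic (h - l + 1) U g"
    by (simp_all add: left_axially_polyharmonic_def right_axially_polyharmonic_def)
qed

theorem theorem4p10:
  fixes U :: "('n::{finite,linorder}) paravector set"
    and f :: "'n paravector \<Rightarrow> 'n clifford"
    and h l :: nat
  assumes "odd CARD('n)"
    and "h = (CARD('n) - 1) div 2"
    and "1 \<le> l" and "l \<le> h"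
    and "open U" and "axially_symmetric U"
  shows "(left_slice_hyperholomorphic U f \<longrightarrow>
            left_axially_polyharmonic (h - l + 1) U (dirac_left ((laplacian ^^ (l - 1)) f))) \<and>
         (right_slice_hyperholomorphic U f \<longrightarrow>
            right_axially_polyharmonic (h - l + 1) U ((laplacian ^^ (l - 1)) (dirac_right f)))"
proof (intro conjI impI)
  have card: "CARD('n) = 2 * h + 1"
    using assms(1,2) by (simp add: odd_two_times_div_two_succ)
  {
    assume "left_slice_hyperholomorphic U f"
    then obtain \<alpha> \<beta> where \<alpha>\<beta>: "slice_pair U \<alpha> \<beta>" and f: "\<And>u v I. (u, v) \<in> slice_domain U \<Longrightarrow>
        I \<in> sphere 0 1 \<Longrightarrow> f (u, v *\<^sub>R I) = \<alpha> (u, v) + vec1 I * \<beta> (u, v)"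
      unfolding left_slice_hyperholomorphic_def by blast
    show "left_axially_polyharmonic (h - l + 1) U (dirac_left ((laplacian ^^ (l - 1)) f))"
    proof (rule axially_polyharmonic_if_local_kernels(1) [OF assms(5,6) card assms(4)])
      fix x assume "x \<in> U"
      from local_axial_kernels [OF assms(5,6) \<alpha>\<beta> this] obtain V J N where
        "axial_kernels V J N" and V: "x \<in> V" "V \<subseteq> U"
        and N: "\<And>y. y \<in> V \<Longrightarrow> \<alpha> (fst y, norm (snd y)) = N 1 y"
        and J: "\<And>y. y \<in> V \<Longrightarrow> \<beta> (fst y, norm (snd y)) = norm (snd y) *\<^sub>R J 1 y"
        and sym: "\<And>y m. fst y = fst x \<Longrightarrow> norm (snd y) = norm (snd x) \<Longrightarrow> y \<in> V \<and> J m y = J m x"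
        by metis
      then interpret axial_kernels V J N by simp
      \<comment> \<open>The norm in the formula for \<beta> recombines with the unit vector into
        \<open>vec1 (snd y)\<close>, so the arbitrary choice of \<open>I\<close> at
        \<open>snd y = 0\<close> disappears.\<close>
      have "f y = S 1 y" if "y \<in> V" for y
      proof -
        obtain I where I: "I \<in> sphere 0 1" "snd y = norm (snd y) *\<^sub>R I"
          using polar_decomposition by blast
        have "f (fst y, norm (snd y) *\<^sub>R I) = N 1 y + vec1 I * (norm (snd y) *\<^sub>R J 1 y)"
          using f [OF norm_snd_in_slice_domain [OF assms(6)] I(1)] that V(2) N J by auto
        moreover have "vec1 (snd y) = norm (snd y) *\<^sub>R vec1 I"
          by (subst I(2)) (rule linear_cmul [OF linear_vec1])
        ultimately show ?thesis
          using I(2) by (metis S_def mult_scaleR_left mult_scaleR_right prod.collapse)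
      qed
      \<comment> \<open>The index moves from 1 to 1 + (l - 1), which is \<open>l\<close> because
        \<open>l\<close> is at least 1.\<close>
      from iterated_laplacian_S [OF this, of "l - 1"] obtain c
        where "\<And>y. y \<in> V \<Longrightarrow> (laplacian ^^ (l - 1)) f y = c *\<^sub>R S l y"
        using assms(3) by auto
      from dirac_left_cong [OF open_V _ this]
      have "dirac_left ((laplacian ^^ (l - 1)) f) y = (c * (2 * real l - 1 - real CARD('n))) *\<^sub>R J l y"
        if "y \<in> V" for y
        using that by (simp add: dirac_left_S)
      with V sym \<open>axial_kernels V J N\<close>
      show "\<exists>V J N c. axial_kernels V J N \<and> x \<in> V \<and> V \<subseteq> U
        \<and> (\<forall>y\<in>V. dirac_left ((laplacian ^^ (l - 1)) f) y = c *\<^sub>R J l y)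
        \<and> (\<forall>y. fst y = fst x \<longrightarrow> norm (snd y) = norm (snd x) \<longrightarrow> y \<in> V \<and> J l y = J l x)"
        by blast
    qed
  }
  {
    assume "right_slice_hyperholomorphic U f"
    then obtain \<alpha> \<beta> where \<alpha>\<beta>: "slice_pair U \<alpha> \<beta>" and f: "\<And>u v I. (u, v) \<in> slice_domain U \<Longrightarrow>
        I \<in> sphere 0 1 \<Longrightarrow> f (u, v *\<^sub>R I) = \<alpha> (u, v) + \<beta> (u, v) * vec1 I"
      unfolding right_slice_hyperholomorphic_def by blast
    show "right_axially_polyharmonic (h - l + 1) U ((laplacian ^^ (l - 1)) (dirac_right f))"
    proof (rule axially_polyharmonic_if_local_kernels(2) [OF assms(5,6) card assms(4)])
      fix x assume "x \<in> U"
      from local_axial_kernels [OF assms(5,6) \<alpha>\<beta> this] obtain V J N where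
        "axial_kernels V J N" and V: "x \<in> V" "V \<subseteq> U"
        and N: "\<And>y. y \<in> V \<Longrightarrow> \<alpha> (fst y, norm (snd y)) = N 1 y"
        and J: "\<And>y. y \<in> V \<Longrightarrow> \<beta> (fst y, norm (snd y)) = norm (snd y) *\<^sub>R J 1 y"
        and sym: "\<And>y m. fst y = fst x \<Longrightarrow> norm (snd y) = norm (snd x) \<Longrightarrow> y \<in> V \<and> J m y = J m x"
        by metis
      then interpret axial_kernels V J N by simp
      have "f y = N 1 y + J 1 y * vec1 (snd y)" if "y \<in> V" for y
      proof -
        obtain I where I: "I \<in> sphere 0 1" "snd y = norm (snd y) *\<^sub>R I"
          using polar_decomposition by blast
        have "f (fst y, norm (snd y) *\<^sub>R I) = N 1 y + norm (snd y) *\<^sub>R J 1 y * vec1 I"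
          using f [OF norm_snd_in_slice_domain [OF assms(6)] I(1)] that V(2) N J by auto
        moreover have "vec1 (snd y) = norm (snd y) *\<^sub>R vec1 I"
          by (subst I(2)) (rule linear_cmul [OF linear_vec1])
        ultimately show ?thesis
          using I(2) by (metis mult_scaleR_left mult_scaleR_right prod.collapse)
      qed
      \<comment> \<open>D acts first, with factor 2 - 1 - n at index 1; the Laplacians then act on
        \<open>J\<close>.\<close>
      from dirac_right_cong [OF open_V _ this]
      have "dirac_right f y = (1 - real CARD('n)) *\<^sub>R J 1 y" if "y \<in> V" for y
        using that dirac_right_S [OF that, of 1] by simp
      from iterated_laplacian_J [OF this, of "l - 1"] obtain c
        where "\<And>y. y \<in> V \<Longrightarrow> (laplacian ^^ (l - 1)) (dirac_right f) y = c *\<^sub>R J l y"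
        using assms(3) by auto
      with V sym \<open>axial_kernels V J N\<close>
      show "\<exists>V J N c. axial_kernels V J N \<and> x \<in> V \<and> V \<subseteq> U
        \<and> (\<forall>y\<in>V. (laplacian ^^ (l - 1)) (dirac_right f) y = c *\<^sub>R J l y)
        \<and> (\<forall>y. fst y = fst x \<longrightarrow> norm (snd y) = norm (snd x) \<longrightarrow> y \<in> V \<and> J l y = J l x)"
        by blast
    qed
  }
qed

end
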